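(* Let $n\ge1$, $\lambda\in\mathcal{SP}_n$ and $\mu=(\mu_1,\mu_2,\dots)\in\mathcal{OP}_n$, and put $\mu^{[1]}=(\mu_2,\mu_3,\dots)$. Then $$\zeta^{\lambda}_{\mu}(q)=\sum_{\nu}2^{\epsilon(\nu)-\epsilon(\lambda)}(q-1)^{-1}\,wt_q(\lambda/\nu)\,\zeta^{\nu}_{\mu^{[1]}}(q),$$ where the sum runs over all strict partitions $\nu\subset\lambda$ such that $\lambda/\nu$ is a $\mu_1$-generalized double strip.
   Context: Partitions: $l(\lambda)$ is the number of nonzero parts; $\mathcal{SP}_n$ (resp. $\mathcal{OP}_n$) is the set of strict partitions (resp. partitions with all parts odd) of $n$; $\delta(\lambda)\in\{0,1\}$ is the parity of $l(\lambda)$; $\epsilon(\lambda)=\lfloor l(\lambda)/2\rfloor$; $z_\lambda=\prod_{i\ge1}i^{m_i}m_i!$ with $m_i$ the multiplicity of $i$ in $\lambda$. Characters: $\Gamma=\mathbb{Q}(q)[p_1,p_3,p_5,\dots]$ is generated by the odd power sums, with the bilinear form $\langle p_\lambda,p_\mu\rangle=2^{-l(\lambda)}z_\lambda\delta_{\lambda\mu}$ for odd partitions. Operators $Q_n$ ($n\in\mathbb Z$) on $\Gamma$ are defined by $\sum_{n}Q_nz^n=\exp\big(\sum_{n\ge1,\,\mathrm{odd}}\frac2n p_nz^n\big)\exp\big(-\sum_{n\ge1,\,\mathrm{odd}}\frac{\partial}{\partial p_n}z^{-n}\big)$, and for strict $\lambda=(\lambda_1,\dots,\lambda_l)$, $Q_\lambda=Q_{\lambda_1}\cdots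 Q_{\lambda_l}.1$ is Schur's $Q$-function; $\langle Q_\lambda,Q_\mu\rangle=2^{l(\lambda)}\delta_{\lambda\mu}$. Let $\sum_{n\ge0}g_nz^n=\exp\big(\sum_{n\ge1,\,\mathrm{odd}}\frac{2(q^n-1)}{n}p_nz^n\big)$ and $g_\mu=g_{\mu_1}g_{\mu_2}\cdots$. $\zeta^\lambda_\mu(q)$ is the value of the irreducible character of the Hecke-Clifford algebra $\mathcal H^c_n$ labelled by $\lambda$ at the standard element $T_{\gamma_\mu}$; it is determined by the Frobenius formula $\frac{g_\mu}{(q-1)^{l(\mu)}}=\sum_{\lambda\in\mathcal{SP}_n}2^{-\frac{l(\lambda)+\delta(\lambda)}2}\zeta^\lambda_\mu(q)Q_\lambda$, equivalently $\zeta^\lambda_\mu(q)=2^{-\epsilon(\lambda)}(q-1)^{-l(\mu)}\langle g_\mu,Q_\lambda\rangle$, which may be taken as its definition ($\zeta^\emptyset_\emptyset=1$). Strips: the shifted diagram $\lambda^*$ of a strict partition $\lambda$ is the set of squares $(i,j)$ with $1\le i\le l(\lambda)$, $i\le j\le i+\lambda_i-1$ (row $i$, column $j$). For strict $\mu\subset\lambda$, $\lambda^*/\mu^*$ is the set difference. It is a generalized strip if it contains no $2\times2$ block of squares and at most one square of the main diagonal $\{(i,i)\}$; a shifted border strip is a connected generalized strip (connectedness via squares sharing an edge). $\lambda/\mu$ is a generalized double strip if there is a strict partition $\nu$, $\mu\subset\nu\subset\lambda$, with $\lambda^*/\nu^*$ and $\nu^*/\mu^*$ both generalized strips (possibly empty);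 it is a $k$-generalized double strip if moreover $|\lambda|-|\mu|=k$. In this case each diagonal $\{(i,j):j-i=\mathrm{const}\}$ meets $\lambda^*/\mu^*$ in at most two squares. Let $c(\lambda/\mu)$ be the number of diagonals meeting $\lambda^*/\mu^*$ in exactly two squares, and let $\beta(\lambda/\mu)$ be the set of squares of $\lambda^*/\mu^*$ on the diagonals meeting it in exactly one square. The connected components $\xi^{(1)},\dots,\xi^{(m)}$ of $\beta(\lambda/\mu)$ are shifted border strips; each $\xi^{(i)}$ is identified with the composition of its row lengths (numbers of squares in its successive nonempty rows, top to bottom), and $l(\xi^{(i)})$ is its number of rows. Weight: $f_0=1$, $f_i=2(t-1)\frac{t^i-(-1)^i}{t+1}$ for $i\ge1$, $f_\tau=f_{\tau_1}f_{\tau_2}\cdots$. For compositions $\rho,\tau$ with positive parts, $\rho\prec\tau$ means that $\tau$ is obtained from $\rho$ by summing consecutive blocks of parts ($\rho$ refines $\tau$; $\tau\prec\tau$). Then $$wt_t(\lambda/\mu)=(-t)^{c(\lambda/\mu)}\,2^{\delta_{l(\lambda),l(\mu)+2}}\prod_{i=1}^m\Big(\sum_{\tau:\ \xi^{(i)}\prec\tau}(-1)^{l(\xi^{(i)})-l(\tau)}f_\tau\Big),$$ with $\delta_{a,b}$ the Kronecker delta, and $wt_q$ is $wt_t$ at $t=q$. *)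

theory Defs
  imports
    "HOL-Library.Poly_Mapping"
    "HOL-Computational_Algebra.Polynomial"
    "HOL-Computational_Algebra.Formal_Power_Series"
    "HOL-Computational_Algebra.Fraction_Field"
begin

section \<open>Partitions\<close>

text \<open>Partitions and compositions are lists of positive integers (nonzero parts only), so
  \<open>l(\<lambda>)\<close> is \<open>length\<close> and \<open>|\<lambda>|\<close> is \<open>sum_list\<close>.\<close>

definition strict_partition :: "nat list \<Rightarrow> bool" where
  "strict_partition lam \<longleftrightarrow> sorted_wrt (>) lam \<and> 0 \<notin> set lam"

definition SP :: "nat \<Rightarrow> nat list set" where
  "SP n = {lam. strict_partition lam \<and> sum_list lam = n}"

definition OP :: "nat \<Rightarrow> nat list set" where
  "OP n = {mu. sorted_wrt (\<ge>) mu \<and> (\<forall>k\<in>set mu. odd k) \<and> sum_list mu = n}"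

definition epsilon :: "nat list \<Rightarrow> nat" where
  "epsilon lam = length lam div 2"

definition contained :: "nat list \<Rightarrow> nat list \<Rightarrow> bool" where
  "contained mu lam \<longleftrightarrow> length mu \<le> length lam \<and> (\<forall>i<length mu. mu ! i \<le> lam ! i)"

section \<open>The ring \<open>\<Gamma> = \<rat>(q)[p\<^sub>1, p\<^sub>3, p\<^sub>5, \<dots>]\<close>\<close>

type_synonym ratfun = "rat poly fract"

definition q :: ratfun where
  "q = Fract [:0, 1:] 1"

text \<open>A monomial is its exponent vector, where position \<open>k\<close> holds the exponent of
  \<open>p\<^bsub>2k+1\<^esub>\<close>. Thus every element of the type is a polynomial in the odd power sums only.\<close>

type_synonym gam = "(nat \<Rightarrow>\<^sub>0 nat) \<Rightarrow>\<^sub>0 ratfun"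

definition const :: "ratfun \<Rightarrow> gam" where
  "const c = Poly_Mapping.single 0 c"

text \<open>\<open>psum n\<close> and \<open>pdiff n\<close> are \<open>p\<^sub>n\<close> and \<open>\<partial>/\<partial>p\<^sub>n\<close>; both are meant for odd \<open>n\<close> only, for which
  \<open>p\<^sub>n\<close> sits at position \<open>n div 2\<close>.\<close>

definition psum :: "nat \<Rightarrow> gam" where
  "psum n = Poly_Mapping.single (Poly_Mapping.single (n div 2) 1) 1"

definition pdiff :: "nat \<Rightarrow> gam \<Rightarrow> gam" where
  "pdiff n f = (\<Sum>m\<in>Poly_Mapping.keys f.
     Poly_Mapping.single (m - Poly_Mapping.single (n div 2) 1)
       (of_nat (Poly_Mapping.lookup m (n div 2)) * Poly_Mapping.lookup f m))"

text \<open>For a monomial \<open>p\<^sub>\<lambda>\<close> given by its exponent vector \<open>m\<close>: \<open>mono_len m = l(\<lambda>)\<close> and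
  \<open>mono_z m = z\<^sub>\<lambda>\<close>.\<close>

definition mono_len :: "(nat \<Rightarrow>\<^sub>0 nat) \<Rightarrow> nat" where
  "mono_len m = (\<Sum>k\<in>Poly_Mapping.keys m. Poly_Mapping.lookup m k)"

definition mono_z :: "(nat \<Rightarrow>\<^sub>0 nat) \<Rightarrow> nat" where
  "mono_z m = (\<Prod>k\<in>Poly_Mapping.keys m.
     (2 * k + 1) ^ Poly_Mapping.lookup m k * fact (Poly_Mapping.lookup m k))"

text \<open>The bilinear form with \<open>\<langle>p\<^sub>\<lambda>, p\<^sub>\<mu>\<rangle> = 2\<^bsup>-l(\<lambda>)\<^esup> z\<^sub>\<lambda> \<delta>\<^bsub>\<lambda>\<mu>\<^esub>\<close>.\<close>

definition pairing :: "gam \<Rightarrow> gam \<Rightarrow> ratfun" where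
  "pairing f g = (\<Sum>m\<in>Poly_Mapping.keys f.
     Poly_Mapping.lookup f m * Poly_Mapping.lookup g m * (of_nat (mono_z m) / 2 ^ mono_len m))"

section \<open>Schur's \<open>Q\<close>-functions, \<open>g\<^sub>n\<close> and the characters\<close>

text \<open>The exponential of a power series without constant term. The library's \<open>fps_exp\<close> needs a
  coefficient field; \<open>\<Gamma>\<close> is only a \<open>\<rat>\<close>-algebra.\<close>

definition gexp :: "gam fps \<Rightarrow> gam fps" where
  "gexp F = fps_compose (Abs_fps (\<lambda>k. const (1 / fact k))) F"

definition raising :: "gam fps" where
  "raising = gexp (Abs_fps (\<lambda>n. if odd n then const (2 / of_nat n) * psum n else 0))"

text \<open>With \<open>w = z\<^sup>-\<^sup>1\<close>, \<open>lower_log\<close> is the operator \<open>- \<Sum>\<^bsub>j odd\<^esub> w\<^sup>j \<partial>/\<partial>p\<^sub>j\<close> on \<open>\<Gamma>[[w]]\<close>, and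
  \<open>lowering f\<close> is the result of applying its exponential to \<open>f \<in> \<Gamma>\<close>. Since \<open>lower_log\<close> raises
  the order in \<open>w\<close>, only the powers \<open>k \<le> m\<close> contribute to the coefficient of \<open>w\<^sup>m\<close>.\<close>

definition lower_log :: "gam fps \<Rightarrow> gam fps" where
  "lower_log F = Abs_fps (\<lambda>n. - (\<Sum>j | odd j \<and> j \<le> n. pdiff j (fps_nth F (n - j))))"

definition lowering :: "gam \<Rightarrow> gam fps" where
  "lowering f = Abs_fps (\<lambda>m. \<Sum>k\<le>m.
     const (1 / fact k) * fps_nth ((lower_log ^^ k) (fps_const f)) m)"

text \<open>The coefficient of \<open>z\<^sup>n\<close>: the \<open>z\<^bsup>n+m\<^esup>\<close> part of the first exponential times the \<open>z\<^bsup>-m\<^esup>\<close> part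
  of the second. The latter vanishes once \<open>m\<close> exceeds the degree of \<open>f\<close> (where \<open>p\<^sub>j\<close> has degree
  \<open>j\<close>), so the sum is finite.\<close>

definition Qop :: "int \<Rightarrow> gam \<Rightarrow> gam" where
  "Qop n f = (\<Sum>m | n + int m \<ge> 0 \<and> fps_nth (lowering f) m \<noteq> 0.
     fps_nth raising (nat (n + int m)) * fps_nth (lowering f) m)"

definition schurQ :: "nat list \<Rightarrow> gam" where
  "schurQ lam = foldr (\<lambda>k. Qop (int k)) lam 1"

definition gfun :: "nat \<Rightarrow> gam" where
  "gfun n = fps_nth
     (gexp (Abs_fps (\<lambda>k. if odd k then const (2 * (q ^ k - 1) / of_nat k) * psum k else 0))) n"

definition gprod :: "nat list \<Rightarrow> gam" where
  "gprod mu = prod_list (map gfun mu)"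

text \<open>\<open>\<zeta>\<^sup>\<lambda>\<^sub>\<mu>(q)\<close>, defined through the Frobenius formula for the Hecke--Clifford algebra.\<close>

definition zeta :: "nat list \<Rightarrow> nat list \<Rightarrow> ratfun" where
  "zeta lam mu = 2 powi (- int (epsilon lam)) * (q - 1) powi (- int (length mu))
     * pairing (gprod mu) (schurQ lam)"

section \<open>Strips\<close>

text \<open>Squares are (row, column), numbered from 1.\<close>

definition shifted_diagram :: "nat list \<Rightarrow> (nat \<times> nat) set" where
  "shifted_diagram lam = {(i, j). 1 \<le> i \<and> i \<le> length lam \<and> i \<le> j \<and> j \<le> i + lam ! (i - 1) - 1}"

definition skew :: "nat list \<Rightarrow> nat list \<Rightarrow> (nat \<times> nat) set" where
  "skew lam mu = shifted_diagram lam - shifted_diagram mu"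

definition generalized_strip :: "(nat \<times> nat) set \<Rightarrow> bool" where
  "generalized_strip S \<longleftrightarrow>
     (\<nexists>i j. {(i, j), (i, j + 1), (i + 1, j), (i + 1, j + 1)} \<subseteq> S) \<and>
     (\<forall>i k. (i, i) \<in> S \<and> (k, k) \<in> S \<longrightarrow> i = k)"

definition double_strip :: "nat list \<Rightarrow> nat list \<Rightarrow> bool" where
  "double_strip lam mu \<longleftrightarrow>
     (\<exists>nu. strict_partition nu \<and> contained mu nu \<and> contained nu lam \<and>
        generalized_strip (skew lam nu) \<and> generalized_strip (skew nu mu))"

definition k_double_strip :: "nat \<Rightarrow> nat list \<Rightarrow> nat list \<Rightarrow> bool" where
  "k_double_strip k lam mu \<longleftrightarrow> double_strip lam mu \<and> sum_list lam = sum_list mu + k"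

definition diagonal :: "int \<Rightarrow> (nat \<times> nat) set" where
  "diagonal d = {(i, j). int j - int i = d}"

definition double_diagonals :: "(nat \<times> nat) set \<Rightarrow> nat" where
  "double_diagonals S = card {d. card (diagonal d \<inter> S) = 2}"

definition beta :: "(nat \<times> nat) set \<Rightarrow> (nat \<times> nat) set" where
  "beta S = (\<Union>d\<in>{d. card (diagonal d \<inter> S) = 1}. diagonal d \<inter> S)"

definition adjacent :: "nat \<times> nat \<Rightarrow> nat \<times> nat \<Rightarrow> bool" where
  "adjacent s t \<longleftrightarrow> \<bar>int (fst s) - int (fst t)\<bar> + \<bar>int (snd s) - int (snd t)\<bar> = 1"

definition components :: "(nat \<times> nat) set \<Rightarrow> (nat \<times> nat) set set" where
  "components S = S // {(s, t). s \<in> S \<and> t \<in> S \<and> adjacent s t}\<^sup>*"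

definition row_lengths :: "(nat \<times> nat) set \<Rightarrow> nat list" where
  "row_lengths S = map (\<lambda>i. card {j. (i, j) \<in> S}) (sorted_list_of_set (fst ` S))"

section \<open>Weight\<close>

text \<open>\<open>refines rho tau\<close> is \<open>\<rho> \<prec> \<tau>\<close>: \<open>bs\<close> cuts \<open>\<rho>\<close> into consecutive nonempty blocks.\<close>

definition refines :: "nat list \<Rightarrow> nat list \<Rightarrow> bool" where
  "refines rho tau \<longleftrightarrow> (\<exists>bs. concat bs = rho \<and> [] \<notin> set bs \<and> map sum_list bs = tau)"

definition fwt :: "'a::field \<Rightarrow> nat \<Rightarrow> 'a" where
  "fwt t i = (if i = 0 then 1 else 2 * (t - 1) * ((t ^ i - (-1) ^ i) / (t + 1)))"

definition fprod :: "'a::field \<Rightarrow> nat list \<Rightarrow> 'a" where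
  "fprod t tau = prod_list (map (fwt t) tau)"

text \<open>The subtraction of lengths below is exact, as \<open>\<rho> \<prec> \<tau>\<close> implies \<open>l(\<tau>) \<le> l(\<rho>)\<close>.\<close>

definition strip_wt :: "'a::field \<Rightarrow> nat list \<Rightarrow> 'a" where
  "strip_wt t rho = (\<Sum>tau | refines rho tau. (-1) ^ (length rho - length tau) * fprod t tau)"

definition wt :: "'a::field \<Rightarrow> nat list \<Rightarrow> nat list \<Rightarrow> 'a" where
  "wt t lam mu = (- t) ^ double_diagonals (skew lam mu)
     * (if length lam = length mu + 2 then 2 else 1)
     * (\<Prod>xi\<in>components (beta (skew lam mu)). strip_wt t (row_lengths xi))"

end

theory Submission
  imports Defs
begin

text \<open>
  By the Frobenius formula the recursion amounts to
  \<open>g\<^sub>k\<^sup>* Q\<^sub>\<lambda> = \<Sum>\<^sub>\<nu> wt\<^sub>q(\<lambda>/\<nu>) Q\<^sub>\<nu>\<close>, where \<open>g\<^sub>k\<^sup>*\<close> is adjoint to multiplication by \<open>g\<^sub>k\<close>. The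
  generating function \<open>E(u) = \<Sum> g\<^sub>k\<^sup>* u\<^sup>k\<close> is the substitution \<open>p\<^sub>j \<mapsto> p\<^sub>j + (q\<^sup>j - 1) u\<^sup>j\<close>, so that
  \<open>E(u) Q(z) = F(uz) Q(z) E(u)\<close> with \<open>F(x) = (1 + qx)(1 - x) / ((1 - qx)(1 + x)) = \<Sum> f\<^sub>i x\<^sup>i\<close>.
  Clearing denominators gives a recursion that expresses \<open>E Q\<^sub>a Q\<^sub>\<lambda>\<close> through \<open>E Q\<^bsub>a-1\<^esub> Q\<^sub>\<lambda>\<close>,
  \<open>E Q\<^bsub>a-2\<^esub> Q\<^sub>\<lambda>\<close> and \<open>E Q\<^sub>\<lambda>\<close>.

  On the combinatorial side, write \<open>h(m)\<close> for the number of parts \<open>\<ge> m\<close> of \<open>\<lambda>\<close> minus that of \<open>\<nu>\<close>; this is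
  the number of squares of \<open>\<lambda>/\<nu>\<close> on the diagonal \<open>j - i = m - 1\<close>. Then \<open>\<lambda>/\<nu>\<close> is a generalized double
  strip iff \<open>h\<close> takes only the values 0, 1, 2, the components of \<open>\<beta>(\<lambda>/\<nu>)\<close> are the maximal intervals on
  which \<open>h = 1\<close>, and the weight is computed by a four-dimensional transfer matrix that reads, from
  the largest \<open>m\<close> down to 1, whether \<open>m\<close> is a part of \<open>\<lambda>\<close> and of \<open>\<nu>\<close>. These transfer matrices satisfy
  the same recursion, which is a finite check.
\<close>

unbundle fps_syntax

section \<open>Scalars, induction and derivations in the polynomial ring\<close>

lemma const_add: "const (a + b) = const a + const b"
  by (simp add: const_def single_add)

lemma const_diff: "const (a - b) = const a - const b"
  by (simp add: const_def single_diff)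

lemma const_mult: "const (a * b) = const a * const b"
  by (simp add: const_def mult_single)

lemma const_0 [simp]: "const 0 = 0" and const_1 [simp]: "const 1 = 1"
  by (simp_all add: const_def)

lemma const_uminus: "const (- a) = - const a"
  by (simp add: const_def single_uminus)

lemma lookup_const_mult [simp]:
  "Poly_Mapping.lookup (const c * f) m = c * Poly_Mapping.lookup f m"
  unfolding const_def mult_map_scale_conv_mult [symmetric]
  by (simp add: Poly_Mapping.map.rep_eq when_def)

text \<open>Nonzero scalars are units of \<open>gam\<close>. This is the division by m in every
  argument below that goes through a logarithmic derivative.\<close>

lemma const_mult_left_cancel:
  assumes "const c * f = const c * g" "c \<noteq> 0"
  shows "f = g"
proof -
  have "const (inverse c) * (const c * f) = const (inverse c) * (const c * g)"
    using assms by simp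
  then show ?thesis using \<open>c \<noteq> 0\<close> by (simp add: mult.assoc [symmetric] const_mult [symmetric])
qed

lemma gam_eqI: "(\<And>m. Poly_Mapping.lookup f m = Poly_Mapping.lookup g m) \<Longrightarrow> f = (g :: gam)"
  by (rule poly_mapping_eqI)

lemma poly_mapping_single_induct [case_names zero single add]:
  fixes P :: "('a \<Rightarrow>\<^sub>0 'b::comm_monoid_add) \<Rightarrow> bool"
  assumes "P 0" "\<And>m c. P (Poly_Mapping.single m c)" "\<And>f g. P f \<Longrightarrow> P g \<Longrightarrow> P (f + g)"
  shows "P f"
proof (induction f rule: update_induct)
  case const
  then show ?case using assms(1) by simp
next
  case (update f a b)
  have "Poly_Mapping.update a b f = f + Poly_Mapping.single a b"
    using update(1) by (intro poly_mapping_eqI) 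
      (auto simp: lookup_update lookup_add lookup_single when_def in_keys_iff)
  then show ?case using update assms by simp
qed

text \<open>The odd power sums generate the ring over the scalars, because position k of an exponent
  vector stands for p_{2k+1}. Operator identities are thus reduced to constants and to commutation
  with \<open>psum j\<close>.\<close>

lemma gam_induct [case_names const mult add]:
  fixes P :: "gam \<Rightarrow> bool"
  assumes c: "\<And>c. P (const c)"
    and m: "\<And>j f. odd j \<Longrightarrow> P f \<Longrightarrow> P (psum j * f)"
    and a: "\<And>f g. P f \<Longrightarrow> P g \<Longrightarrow> P (f + g)"
  shows "P f"
proof (induction f rule: poly_mapping_single_induct)
  case zero
  show ?case using c[of 0] by simp
next
  case (single m c)
  \<comment> \<open>Generalised to an arbitrary cofactor h, so that the monomial can be peeled off
    one variable at a time.\<close>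
  have "P h \<Longrightarrow> P (Poly_Mapping.single m 1 * h)" for h
  proof (induction m arbitrary: h rule: poly_mapping_single_induct)
    case zero
    then show ?case by simp
  next
    case (single k v)
    then show ?case
    proof (induction v arbitrary: h)
      case (Suc v)
      have "Poly_Mapping.single (Poly_Mapping.single k (Suc v)) 1 * h
          = psum (2 * k + 1) * (Poly_Mapping.single (Poly_Mapping.single k v) 1 * h)"
        by (simp add: psum_def mult.assoc [symmetric] mult_single single_add [symmetric])
      moreover have "P (psum (2 * k + 1) * (Poly_Mapping.single (Poly_Mapping.single k v) 1 * h))"
        using Suc by (intro m) simp_all
      ultimately show ?case by (simp only:)
    qed simp
  next
    case (add m m')
    have "Poly_Mapping.single (m + m') 1 * h
        = Poly_Mapping.single m 1 * (Poly_Mapping.single m' 1 * h)"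
      by (simp add: mult.assoc [symmetric] mult_single)
    then show ?case using add by (simp only:)
  qed
  from this[OF c[of c]] show ?case by (simp add: const_def mult_single)
qed (use a in auto)

lemma lookup_minus_nat: "Poly_Mapping.lookup (f - g) k = Poly_Mapping.lookup f k - Poly_Mapping.lookup g k"
  for f g :: "'a \<Rightarrow>\<^sub>0 nat"
  by transfer simp

lemma lookup_pdiff: "Poly_Mapping.lookup (pdiff n f) m =
   of_nat (Poly_Mapping.lookup m (n div 2) + 1) * Poly_Mapping.lookup f (m + Poly_Mapping.single (n div 2) 1)"
proof -
  let ?k = "n div 2" let ?e = "Poly_Mapping.single (n div 2) 1 :: nat \<Rightarrow>\<^sub>0 nat"
  \<comment> \<open>Truncated subtraction also sends monomials without the variable to m, but their
    coefficient carries the factor 0.\<close>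
  have *: "(of_nat (Poly_Mapping.lookup m' ?k) * Poly_Mapping.lookup f m' when m' - ?e = m) =
     (if m' = m + ?e then of_nat (Poly_Mapping.lookup m ?k + 1) * Poly_Mapping.lookup f (m + ?e) else 0)" for m'
  proof (cases "Poly_Mapping.lookup m' ?k = 0")
    case True
    then have "m' \<noteq> m + ?e" by (auto simp: lookup_add)
    with True show ?thesis by simp
  next
    case False
    then have "m' = (m' - ?e) + ?e"
      by (intro poly_mapping_eqI) (auto simp: lookup_add lookup_minus_nat lookup_single when_def)
    then have "m' - ?e = m \<longleftrightarrow> m' = m + ?e" by auto
    then show ?thesis by (auto simp: lookup_add)
  qed
  have "Poly_Mapping.lookup (pdiff n f) m = (\<Sum>m'\<in>Poly_Mapping.keys f. 
     if m' = m + ?e then of_nat (Poly_Mapping.lookup m ?k + 1) * Poly_Mapping.lookup f (m + ?e) else 0)"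
    unfolding pdiff_def lookup_sum lookup_single * ..
  also have "\<dots> = of_nat (Poly_Mapping.lookup m ?k + 1) * Poly_Mapping.lookup f (m + ?e)"
    by (simp add: sum.delta in_keys_iff)
  finally show ?thesis .
qed

lemma pdiff_add: "pdiff n (f + g) = pdiff n f + pdiff n g"
  by (rule gam_eqI) (simp add: lookup_pdiff lookup_add algebra_simps)

lemma pdiff_0 [simp]: "pdiff n 0 = 0"
  by (rule gam_eqI) (simp add: lookup_pdiff)

lemma pdiff_sum: "pdiff n (sum f A) = (\<Sum>x\<in>A. pdiff n (f x))"
  by (induction A rule: infinite_finite_induct) (auto simp: pdiff_add)

lemma pdiff_const_mult: "pdiff n (const c * f) = const c * pdiff n f"
  by (rule gam_eqI) (simp add: lookup_pdiff)

lemma pdiff_const [simp]: "pdiff n (const c) = 0"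
proof (rule gam_eqI)
  fix m :: "nat \<Rightarrow>\<^sub>0 nat"
  have "Poly_Mapping.lookup (m + Poly_Mapping.single (n div 2) 1) (n div 2) \<noteq> 0"
    by (simp add: lookup_add)
  then have "m + Poly_Mapping.single (n div 2) 1 \<noteq> 0" by auto
  then show "Poly_Mapping.lookup (pdiff n (const c)) m = Poly_Mapping.lookup 0 m"
    by (auto simp: lookup_pdiff const_def lookup_single when_def)
qed

lemma pdiff_1 [simp]: "pdiff n 1 = 0"
  using pdiff_const[of n 1] by simp

lemma pdiff_commute: "pdiff i (pdiff j f) = pdiff j (pdiff i f)"
  by (rule gam_eqI) (simp add: lookup_pdiff lookup_add lookup_single when_def algebra_simps)

lemma pdiff_single: "pdiff n (Poly_Mapping.single m c) =
  Poly_Mapping.single (m - Poly_Mapping.single (n div 2) 1) (of_nat (Poly_Mapping.lookup m (n div 2)) * c)"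
  by (cases "c = 0") (simp_all add: pdiff_def)

lemma pdiff_psum_mult:
  assumes "odd i" "odd j"
  shows "pdiff i (psum j * f) = psum j * pdiff i f + (if i = j then f else 0)"
proof (induction f rule: poly_mapping_single_induct)
  case (add f g)
  then show ?case by (simp only: distrib_left pdiff_add) simp
next
  case (single m c)
  let ?e = "\<lambda>j. Poly_Mapping.single (j div 2) 1 :: nat \<Rightarrow>\<^sub>0 nat"
  have psum: "psum j * Poly_Mapping.single m c = Poly_Mapping.single (?e j + m) c" for m c
    by (simp add: psum_def mult_single)
  show ?case
  proof (cases "i = j")
    case True
    have "Poly_Mapping.single m (of_nat (Poly_Mapping.lookup m (j div 2)) * c)
        = psum j * pdiff j (Poly_Mapping.single m c)"
    proof (cases "Poly_Mapping.lookup m (j div 2) = 0")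
      case False
      then have "?e j + (m - ?e j) = m"
        by (intro poly_mapping_eqI) (auto simp: lookup_add lookup_minus_nat lookup_single when_def)
      then show ?thesis by (simp add: pdiff_single psum)
    qed (simp add: pdiff_single)
    moreover have "pdiff j (psum j * Poly_Mapping.single m c) =
        Poly_Mapping.single m (of_nat (Poly_Mapping.lookup m (j div 2)) * c) + Poly_Mapping.single m c"
      unfolding psum pdiff_single lookup_add by (simp add: distrib_right single_add)
    ultimately show ?thesis using True by simp
  next
    case False
    then have ne: "i div 2 \<noteq> j div 2" using assms by (metis odd_two_times_div_two_succ)
    have "?e j + m - ?e i = ?e j + (m - ?e i)"
      using ne by (intro poly_mapping_eqI) (auto simp: lookup_add lookup_minus_nat lookup_single when_def)
    then show ?thesis using False ne
      by (simp only: psum pdiff_single) (simp add: lookup_add lookup_single)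
  qed
qed simp

lemma pdiff_mult: 
  assumes "odd i"
  shows "pdiff i (f * g) = pdiff i f * g + f * pdiff i g"
proof (induction f rule: gam_induct)
  case (mult j f)
  then show ?case using assms
    unfolding mult.assoc pdiff_psum_mult [OF assms mult(1)]
    by (simp add: algebra_simps)
next
  case (add f f')
  then show ?case by (simp only: distrib_right pdiff_add) simp
qed (simp add: pdiff_const_mult)

section \<open>Sums over odd indices and induction over integer indices\<close>

abbreviation odds :: "nat \<Rightarrow> nat set" where
  "odds N \<equiv> {j. odd j \<and> j \<le> N}"

text \<open>Gives convolutions over odd j a two-step recursion, so closed forms follow by induction
  in steps of two.\<close>

lemma sum_odds_Suc_Suc:
  "(\<Sum>j\<in>odds (Suc (Suc m)). \<phi> j) = \<phi> 1 + (\<Sum>j\<in>odds m. \<phi> (Suc (Suc j)))"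
proof -
  have "odds (Suc (Suc m)) = insert 1 ((Suc \<circ> Suc) ` odds m)"
  proof (intro equalityI subsetI)
    fix j assume j: "j \<in> odds (Suc (Suc m))"
    show "j \<in> insert 1 ((Suc \<circ> Suc) ` odds m)"
    proof (cases "j = 1")
      case False
      with j obtain i where "j = Suc (Suc i)" by (cases j; cases "j - 1") auto
      with j show ?thesis by auto
    qed simp
  qed auto
  moreover have "1 \<notin> (Suc \<circ> Suc) ` odds m" by auto
  ultimately show ?thesis by (simp add: sum.reindex inj_on_def)
qed

lemma sum_odds_0 [simp]: "(\<Sum>j\<in>odds 0. \<phi> j) = 0"
  by (rule sum.neutral) (auto elim: oddE)

lemma sum_odds_1 [simp]: "(\<Sum>j\<in>odds (Suc 0). \<phi> j) = \<phi> 1"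
proof -
  have "odds (Suc 0) = {1}" by (auto elim: oddE simp: le_Suc_eq)
  then show ?thesis by simp
qed

text \<open>Coefficient families are indexed by integers and vanish at negative indices; this is the
  matching induction.\<close>

lemma int_strong_induct [case_names neg step]:
  fixes P :: "int \<Rightarrow> bool"
  assumes "\<And>m. m < 0 \<Longrightarrow> P m" and step: "\<And>m. 0 \<le> m \<Longrightarrow> (\<And>k. k < m \<Longrightarrow> P k) \<Longrightarrow> P m"
  shows "P m"
proof (induction "nat m" arbitrary: m rule: less_induct)
  case less
  show ?case
  proof (cases "m < 0")
    case False
    show ?thesis
    proof (rule step)
      fix k assume "k < m"
      show "P k"
      proof (cases "k < 0")
        case False
        then show ?thesis using \<open>k < m\<close> by (intro less) auto
      qed (use assms in auto)
    qed (use False in auto)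
  qed (use assms in auto)
qed

subsection \<open>Flows of the vector fields \<open>\<Sum> (a\<^sub>j / j) u\<^sup>j \<partial>/\<partial>p\<^sub>j\<close>\<close>

text \<open>The coefficient of \<open>u\<^sup>m\<close> in \<open>exp (\<Sum> (a\<^sub>j / j) u\<^sup>j \<partial>/\<partial>p\<^sub>j) f\<close>, through its logarithmic derivative.\<close>

function flow_nat :: "(nat \<Rightarrow> ratfun) \<Rightarrow> nat \<Rightarrow> gam \<Rightarrow> gam" where
  "flow_nat a m f = (if m = 0 then f else
     const (1 / of_nat m) * (\<Sum>j\<in>odds m. const (a j) * pdiff j (flow_nat a (m - j) f)))"
  by pat_completeness auto
termination by (relation "measure (\<lambda>(_, m, _). m)") (auto elim!: oddE)

declare flow_nat.simps [simp del]

text \<open>Extended by zero to negative indices, so that index shifts need no side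
  conditions.\<close>

definition flow :: "(nat \<Rightarrow> ratfun) \<Rightarrow> int \<Rightarrow> gam \<Rightarrow> gam" where
  "flow a m f = (if m < 0 then 0 else flow_nat a (nat m) f)"

lemma flow_neg [simp]: "m < 0 \<Longrightarrow> flow a m f = 0"
  by (simp add: flow_def)

lemma flow_0 [simp]: "flow a 0 f = f"
  by (simp add: flow_def flow_nat.simps)

text \<open>The terms with j > m vanish, so any bound N above m is allowed; recursions for different
  m can then share one summation range.\<close>

lemma flow_rec:
  assumes "m \<le> int N"
  shows "const (of_int m) * flow a m f = (\<Sum>j\<in>odds N. const (a j) * pdiff j (flow a (m - int j) f))"
proof (cases "m \<le> 0")
  case True
  have "(\<Sum>j\<in>odds N. const (a j) * pdiff j (flow a (m - int j) f)) = 0"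
    using True by (intro sum.neutral ballI) (auto elim!: oddE)
  then show ?thesis using True by (cases "m = 0") auto
next
  case False
  then obtain n where n: "m = int n" "n > 0" by (metis not_le zero_less_imp_eq_int)
  have "const (of_int m) * flow a m f =
     (\<Sum>j\<in>odds n. const (a j) * pdiff j (flow_nat a (n - j) f))"
    using n unfolding flow_def
    by (subst flow_nat.simps) (simp add: mult.assoc [symmetric] const_mult [symmetric])
  also have "\<dots> = (\<Sum>j\<in>odds n. const (a j) * pdiff j (flow a (m - int j) f))"
    using n by (intro sum.cong) (auto simp: flow_def nat_diff_distrib)
  also have "\<dots> = (\<Sum>j\<in>odds N. const (a j) * pdiff j (flow a (m - int j) f))"
    using n assms by (intro sum.mono_neutral_left ballI) (auto simp: flow_def)
  finally show ?thesis .
qed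

lemma flow_rec_nat:
  "const (of_int m) * flow a m f = (\<Sum>j\<in>odds (nat m). const (a j) * pdiff j (flow a (m - int j) f))"
  by (rule flow_rec) simp

text \<open>In characteristic 0 the logarithmic derivative and the constant term determine the
  series. Most identities for flows below are proved by checking this recursion.\<close>

lemma flow_unique:
  assumes neg: "\<And>k. k < 0 \<Longrightarrow> F k = 0" and "F 0 = f"
    and rec: "\<And>m. m > 0 \<Longrightarrow>
      const (of_int m) * F m = (\<Sum>j\<in>odds (nat m). const (a j) * pdiff j (F (m - int j)))"
  shows "F m = flow a m f"
proof (induction m rule: int_strong_induct)
  case (step m)
  show ?case
  proof (cases "m = 0")
    case False
    have "const (of_int m) * F m = const (of_int m) * flow a m f"
      using False step by (simp add: rec flow_rec [of m "nat m"])
        (intro sum.cong, auto elim!: oddE)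
    then show ?thesis
      by (rule const_mult_left_cancel) (use False in simp)
  qed (use assms in auto)
qed (use neg in auto)

lemma flow_add: "flow a m (f + g) = flow a m f + flow a m g"
  by (rule flow_unique [symmetric])
    (auto simp: distrib_left flow_rec_nat pdiff_add sum.distrib)

lemma flow_const_mult: "flow a m (const c * f) = const c * flow a m f"
  by (rule flow_unique [symmetric])
    (simp_all add: mult.left_commute [of "const _" "const c"] flow_rec_nat
       pdiff_const_mult sum_distrib_left)

lemma flow_zero [simp]: "flow a m 0 = 0"
  using flow_const_mult [of a m 0 0] by simp

lemma flow_sum: "flow a m (sum f A) = (\<Sum>x\<in>A. flow a m (f x))"
  by (induction A rule: infinite_finite_induct) (auto simp: flow_add)

lemma flow_pdiff: "flow a m (pdiff i f) = pdiff i (flow a m f)"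
proof (rule flow_unique [symmetric])
  fix m :: int
  have "const (of_int m) * pdiff i (flow a m f) = pdiff i (const (of_int m) * flow a m f)"
    by (simp add: pdiff_const_mult)
  also have "\<dots> = (\<Sum>j\<in>odds (nat m). const (a j) * pdiff j (pdiff i (flow a (m - int j) f)))"
    by (subst flow_rec_nat) (simp only: pdiff_sum pdiff_const_mult pdiff_commute)
  finally show "const (of_int m) * pdiff i (flow a m f) = \<dots>" .
qed auto

text \<open>The vector fields have constant coefficients. Since \<open>flow b k\<close> commutes
  with each \<open>pdiff j\<close>, it carries the recursion for \<open>flow a\<close> into
  itself.\<close>

lemma flow_commute: "flow a m (flow b k f) = flow b k (flow a m f)"
proof (rule flow_unique [symmetric])
  fix m :: int
  have "const (of_int m) * flow b k (flow a m f) = flow b k (const (of_int m) * flow a m f)"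
    by (simp add: flow_const_mult)
  also have "\<dots> = (\<Sum>j\<in>odds (nat m). const (a j) * pdiff j (flow b k (flow a (m - int j) f)))"
    by (subst flow_rec_nat) (simp only: flow_sum flow_const_mult flow_pdiff)
  finally show "const (of_int m) * flow b k (flow a m f) = \<dots>" .
qed auto

lemma flow_const: "flow a m (const c) = (if m = 0 then const c else 0)"
  by (rule flow_unique [symmetric]) (auto intro!: sum.neutral)

lemma sum_int_shift:
  fixes \<phi> :: "int \<Rightarrow> 'a::comm_monoid_add"
  assumes "j \<ge> 0" "\<And>i. i < 0 \<Longrightarrow> \<phi> i = 0" "\<And>i. i > M - j \<Longrightarrow> \<phi> i = 0"
  shows "(\<Sum>i\<in>{0..M}. \<phi> (i - j)) = (\<Sum>i\<in>{0..M}. \<phi> i)"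
proof -
  have "(\<Sum>i\<in>{0..M}. \<phi> (i - j)) = (\<Sum>i\<in>{-j..M-j}. \<phi> i)"
    by (rule sum.reindex_bij_witness [of _ "\<lambda>i. i + j" "\<lambda>i. i - j"]) auto
  also have "\<dots> = (\<Sum>i\<in>{-j..M}. \<phi> i)"
    using assms by (intro sum.mono_neutral_left) auto
  also have "\<dots> = (\<Sum>i\<in>{0..M}. \<phi> i)"
    using assms by (intro sum.mono_neutral_right) auto
  finally show ?thesis .
qed

text \<open>The exponential of a derivation is a ring homomorphism: by the Leibniz rule the Cauchy
  product satisfies the defining recursion.\<close>

lemma flow_mult: 
  assumes "m \<le> M"
  shows "flow a m (f * g) = (\<Sum>i\<in>{0..M}. flow a i f * flow a (m - i) g)"
proof -
  let ?F = "\<lambda>m. \<Sum>i\<in>{0..m}. flow a i f * flow a (m - i) g"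
  have "flow a m (f * g) = ?F m"
  proof (rule flow_unique [symmetric])
    fix m :: int assume m: "m > 0"
    let ?N = "nat m"
    have shift: "(\<Sum>i\<in>{0..m}. pdiff j (flow a (i - int j) f) * flow a (m - i) g)
        = (\<Sum>i\<in>{0..m}. pdiff j (flow a i f) * flow a (m - int j - i) g)" for j
      using sum_int_shift [where j = "int j" and M = m and
        \<phi> = "\<lambda>i. pdiff j (flow a i f) * flow a (m - int j - i) g"] by (simp add: algebra_simps)
    \<comment> \<open>Writing m = i + (m - i) differentiates the product of the two series factor by
      factor.\<close>
    have "const (of_int m) * ?F m = (\<Sum>i\<in>{0..m}. (const (of_int i) * flow a i f) * flow a (m - i) g
        + flow a i f * (const (of_int (m - i)) * flow a (m - i) g))"
      unfolding sum_distrib_left by (intro sum.cong refl) (simp add: const_diff algebra_simps)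
    also have "\<dots> = (\<Sum>i\<in>{0..m}. \<Sum>j\<in>odds ?N. const (a j) *
        (pdiff j (flow a (i - int j) f) * flow a (m - i) g
          + flow a i f * pdiff j (flow a (m - i - int j) g)))"
      by (intro sum.cong refl, subst (1 2) flow_rec [where N = ?N])
        (auto simp: sum_distrib_left sum_distrib_right sum.distrib [symmetric] algebra_simps
          intro!: sum.cong)
    also have "\<dots> = (\<Sum>j\<in>odds ?N. const (a j) *
        ((\<Sum>i\<in>{0..m}. pdiff j (flow a (i - int j) f) * flow a (m - i) g)
          + (\<Sum>i\<in>{0..m}. flow a i f * pdiff j (flow a (m - i - int j) g))))"
      by (subst sum.swap) (simp add: sum_distrib_left sum.distrib distrib_left)
    also have "\<dots> = (\<Sum>j\<in>odds ?N. const (a j) *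
        (\<Sum>i\<in>{0..m}. pdiff j (flow a i f * flow a (m - int j - i) g)))"
      unfolding shift
      by (intro sum.cong refl) (auto simp: sum.distrib [symmetric] pdiff_mult algebra_simps)
    also have "\<dots> = (\<Sum>j\<in>odds ?N. const (a j) * pdiff j (?F (m - int j)))"
      unfolding pdiff_sum
      by (intro sum.cong refl arg_cong2 [where f = "(*)"] sum.mono_neutral_right) auto
    finally show "const (of_int m) * ?F m = (\<Sum>j\<in>odds ?N. const (a j) * pdiff j (?F (m - int j)))" .
  qed auto
  also have "?F m = (\<Sum>i\<in>{0..M}. flow a i f * flow a (m - i) g)"
    using assms by (intro sum.mono_neutral_left) auto
  finally show ?thesis .
qed

subsection \<open>Exponentials of linear combinations of the power sums\<close>

lemma const_of_nat: "const (of_nat n) = of_nat n"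
  by (simp add: const_def)

text \<open>Compares coefficients in z G' = (z F') G for G = exp F.\<close>

lemma gexp_rec:
  assumes "F $ 0 = 0"
  shows "of_nat n * gexp F $ n = (\<Sum>j\<le>n. of_nat j * F $ j * gexp F $ (n - j))"
proof (cases n)
  case (Suc k)
  let ?e = "Abs_fps (\<lambda>k. const (1 / fact k))"
  have "fps_deriv ?e = ?e"
    by (intro fps_ext) (simp add: const_mult [symmetric] const_of_nat [symmetric] del: of_nat_Suc)
  then have "fps_deriv (gexp F) = gexp F * fps_deriv F"
    using fps_compose_deriv [OF assms, of ?e] by (simp add: gexp_def)
  then have "fps_deriv (gexp F) $ k = (fps_deriv F * gexp F) $ k"
    by (simp add: mult.commute)
  also have "\<dots> = (\<Sum>j\<le>k. of_nat (Suc j) * F $ Suc j * gexp F $ (n - Suc j))"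
    by (simp add: fps_mult_nth Suc atLeast0AtMost)
  also have "\<dots> = (\<Sum>j\<le>n. of_nat j * F $ j * gexp F $ (n - j))"
    unfolding Suc sum.atMost_Suc_shift by simp
  finally show ?thesis by (simp add: Suc)
qed simp

lemma gexp_0 [simp]: "gexp F $ 0 = 1"
  by (simp add: gexp_def)

text \<open>The coefficient of z^n in exp(sum over odd j of (2 b_j / j) p_j z^j). With b_j = 1 this
  is the first exponential in the definition of Q_n, with b_j = q^j - 1 it is g_n.\<close>

definition wave :: "(nat \<Rightarrow> ratfun) \<Rightarrow> int \<Rightarrow> gam" where
  "wave b n = (if n < 0 then 0 else
     gexp (Abs_fps (\<lambda>j. if odd j then const (2 * b j / of_nat j) * psum j else 0)) $ nat n)"

lemma wave_neg [simp]: "n < 0 \<Longrightarrow> wave b n = 0"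
  and wave_0 [simp]: "wave b 0 = 1"
  by (simp_all add: wave_def)

lemma wave_rec:
  assumes "n \<le> int N"
  shows "const (of_int n) * wave b n = (\<Sum>j\<in>odds N. const (2 * b j) * psum j * wave b (n - int j))"
proof (cases "n < 0")
  case True
  then show ?thesis by (auto intro!: sum.neutral [symmetric])
next
  case False
  then obtain m where n: "n = int m" by (metis nonneg_int_cases not_less)
  define F where "F = Abs_fps (\<lambda>j. if odd j then const (2 * b j / of_nat j) * psum j else 0)"
  have wave: "wave b (int k) = gexp F $ k" for k
    by (simp add: wave_def F_def)
  have [simp]: "F $ 0 = 0" by (simp add: F_def)
  have F: "of_nat j * F $ j = (if odd j then const (2 * b j) * psum j else 0)" for j
    unfolding const_of_nat [symmetric]
    by (cases "j = 0") (simp_all add: F_def mult.assoc [symmetric] const_mult [symmetric])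
  have "const (of_int n) * wave b n = of_nat m * gexp F $ m"
    by (simp add: n wave const_def)
  also have "\<dots> = (\<Sum>j\<in>odds m. const (2 * b j) * psum j * wave b (n - int j))"
    unfolding gexp_rec [OF \<open>F $ 0 = 0\<close>] F
    by (rule sum.mono_neutral_cong_right) (auto simp: n wave [symmetric] of_nat_diff)
  also have "\<dots> = (\<Sum>j\<in>odds N. const (2 * b j) * psum j * wave b (n - int j))"
    using n assms by (intro sum.mono_neutral_left ballI) (auto simp: wave_def)
  finally show ?thesis .
qed

lemma pdiff_psum: "odd i \<Longrightarrow> odd j \<Longrightarrow> pdiff i (psum j) = (if i = j then 1 else 0)"
  using pdiff_psum_mult [of i j 1] by simp

text \<open>The generating series is an eigenvector of each partial derivative, with eigenvalue (2
  b_i / i) z^i.\<close>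

lemma pdiff_wave:
  assumes "odd i"
  shows "pdiff i (wave b n) = const (2 * b i / of_nat i) * wave b (n - int i)"
proof (induction n rule: int_strong_induct)
  case (step n)
  let ?N = "nat n"
  have "i > 0" using assms by (auto elim: oddE)
  have pd: "pdiff i (const c * psum j * f) = const c * psum j * pdiff i f + (if i = j then const c * f else 0)"
    if "odd j" for c j f
    unfolding mult.assoc pdiff_const_mult pdiff_psum_mult [OF assms that] by (simp add: distrib_left)
  show ?case
  proof (cases "n = 0")
    case False
    have "const (of_int n) * pdiff i (wave b n) = pdiff i (const (of_int n) * wave b n)"
      by (simp add: pdiff_const_mult)
    also have "\<dots> = (\<Sum>j\<in>odds ?N. const (2 * b j) * psum j * pdiff i (wave b (n - int j))
        + (if i = j then const (2 * b i) * wave b (n - int i) else 0))"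
      by (subst wave_rec [of n ?N]) (auto simp: pdiff_sum pd intro!: sum.cong)
    also have "\<dots> = (\<Sum>j\<in>odds ?N. const (2 * b j) * psum j * (const (2 * b i / of_nat i) * wave b (n - int i - int j)))
        + (\<Sum>j\<in>odds ?N. if i = j then const (2 * b i) * wave b (n - int i) else 0)"
      unfolding sum.distrib
      by (intro arg_cong2 [where f = "(+)"] sum.cong refl arg_cong2 [where f = "(*)"], subst step)
        (auto elim!: oddE simp: algebra_simps)
    also have "(\<Sum>j\<in>odds ?N. if i = j then const (2 * b i) * wave b (n - int i) else 0)
        = const (2 * b i) * wave b (n - int i)"
      using assms by (subst sum.delta') (auto simp: wave_def)
    also have "(\<Sum>j\<in>odds ?N. const (2 * b j) * psum j * (const (2 * b i / of_nat i) * wave b (n - int i - int j)))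
        = const (2 * b i / of_nat i) * (const (of_int (n - int i)) * wave b (n - int i))"
      by (subst wave_rec [of "n - int i" ?N]) (simp_all add: sum_distrib_left mult_ac)
    also have "\<dots> + const (2 * b i) * wave b (n - int i)
        = const (of_int n) * (const (2 * b i / of_nat i) * wave b (n - int i))"
      using \<open>i > 0\<close> 
      by (simp add: mult.assoc [symmetric] const_mult [symmetric] distrib_right [symmetric] const_add [symmetric])
        (simp add: field_simps)
    finally show ?thesis
      by (rule const_mult_left_cancel) (use False in simp)
  qed (use \<open>i > 0\<close> in auto)
qed (use assms in auto)

text \<open>\<open>flow_coeff a d\<close> says that \<open>\<Sum> d\<^sub>m x\<^sup>m = exp (\<Sum> (2 a\<^sub>j / j\<^sup>2) x\<^sup>j)\<close>, through the logarithmic derivative.\<close>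

definition flow_coeff :: "(nat \<Rightarrow> ratfun) \<Rightarrow> (int \<Rightarrow> ratfun) \<Rightarrow> bool" where
  "flow_coeff a d \<longleftrightarrow> d 0 = 1 \<and> (\<forall>m<0. d m = 0) \<and>
     (\<forall>m. of_nat m * d (int m) = (\<Sum>j\<in>odds m. 2 * a j / of_nat j * d (int m - int j)))"

text \<open>By the eigenvector property with b_j = 1, the flow multiplies X(z) by exp(sum over odd j
  of (2 a_j / j^2) (uz)^j), whose coefficients are the d_m.\<close>

lemma flow_wave:
  assumes "flow_coeff a d"
  shows "flow a m (wave (\<lambda>_. 1) n) = const (d m) * wave (\<lambda>_. 1) (n - m)"
proof (rule flow_unique [symmetric])
  fix m :: int assume m: "m > 0"
  have "of_nat (nat m) * d (int (nat m)) = (\<Sum>j\<in>odds (nat m). 2 * a j / of_nat j * d (int (nat m) - int j))"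
    using assms by (simp only: flow_coeff_def)
  then have d: "of_int m * d m = (\<Sum>j\<in>odds (nat m). 2 * a j / of_nat j * d (m - int j))"
    using m by simp
  have const_sum: "const (sum f A) = (\<Sum>x\<in>A. const (f x))" for f and A :: "nat set"
    by (induction A rule: infinite_finite_induct) (simp_all add: const_add)
  have "const (of_int m) * (const (d m) * wave (\<lambda>_. 1) (n - m))
      = const (of_int m * d m) * wave (\<lambda>_. 1) (n - m)"
    by (simp add: const_mult mult.assoc)
  also have "\<dots> = (\<Sum>j\<in>odds (nat m). const (2 * a j / of_nat j * d (m - int j)) * wave (\<lambda>_. 1) (n - m))"
    unfolding d const_sum sum_distrib_right ..
  also have "\<dots> = (\<Sum>j\<in>odds (nat m). const (a j) * pdiff j (const (d (m - int j)) * wave (\<lambda>_. 1) (n - (m - int j))))"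
  proof (intro sum.cong refl)
    fix j assume "j \<in> odds (nat m)"
    then have "odd j" by simp
    then show "const (2 * a j / of_nat j * d (m - int j)) * wave (\<lambda>_. 1) (n - m) =
        const (a j) * pdiff j (const (d (m - int j)) * wave (\<lambda>_. 1) (n - (m - int j)))"
      unfolding pdiff_const_mult pdiff_wave [OF \<open>odd j\<close>] mult.assoc [symmetric] const_mult [symmetric]
      by (simp add: mult_ac)
  qed
  finally show "const (of_int m) * (const (d m) * wave (\<lambda>_. 1) (n - m)) = \<dots>" .
qed (use assms in \<open>auto simp: flow_coeff_def\<close>)

text \<open>Here the series is exp(-2 sum over odd j of x^j / j) = (1 - x) / (1 + x).\<close>

lemma flow_coeff_lowering: "flow_coeff (\<lambda>j. - of_nat j) (\<lambda>m. if m < 0 then 0 else if m = 0 then 1 else 2 * (-1) ^ nat m)"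
  (is "flow_coeff ?a ?d")
proof -
  have "(\<Sum>j\<in>odds m. - 2 * ?d (int m - int j)) = of_nat m * ?d (int m)" for m
  proof (induction m rule: induct_nat_012)
    case 0
    show ?case by (subst sum_odds_0) simp
  next
    case (ge2 m)
    have *: "int (Suc (Suc m)) - int (Suc (Suc j)) = int m - int j" for j by simp
    show ?case unfolding sum_odds_Suc_Suc * ge2(1)
      by (cases "m = 0") (auto simp: nat_add_distrib nat_diff_distrib algebra_simps)
  qed auto
  moreover have "(\<Sum>j\<in>odds m. 2 * ?a j / of_nat j * ?d (int m - int j)) =
      (\<Sum>j\<in>odds m. - 2 * ?d (int m - int j))" for m
    by (intro sum.cong refl arg_cong2 [where f = "(*)"]) (auto simp: odd_pos)
  ultimately show ?thesis by (simp add: flow_coeff_def)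
qed

lemma q_plus_1_neq_0: "q + 1 \<noteq> 0"
  and q_minus_1_neq_0: "q - 1 \<noteq> 0"
  by (simp_all add: q_def One_fract_def Zero_fract_def eq_fract one_pCons)

text \<open>Chosen so that the vector field is the sum of (q^j - 1) u^j d/dp_j, which is the adjoint
  of the exponent of g(u).\<close>

definition gderiv :: "nat \<Rightarrow> ratfun" where
  "gderiv j = of_nat j * (q ^ j - 1)"

text \<open>The series is exp(sum over odd j of (2 (q^j - 1) / j) x^j) = F(x). Its logarithmic
  derivative splits into the convolutions A and B, each with a closed form.\<close>

lemma flow_coeff_fwt: "flow_coeff gderiv (\<lambda>m. if m < 0 then 0 else fwt q (nat m))"
  (is "flow_coeff _ ?d")
proof -
  let ?a = gderiv
  \<comment> \<open>Partial fractions. A has generating function q x (1 - x) / ((1 - q x)^2 (1 +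
    x)): \<alpha> belongs to its double pole, \<gamma> to its pole at x = -1. For B, which is x (1 +
    q x) / ((1 - q x) (1 + x)^2), they are \<alpha> and -\<gamma>.\<close>
  define \<alpha> where "\<alpha> = (q - 1) / (q + 1)"
  define \<gamma> where "\<gamma> = - 2 * q / (q + 1)\<^sup>2"
  have q1: "q + 1 \<noteq> 0" by (rule q_plus_1_neq_0)
  have f: "fwt q m = 2 * \<alpha> * (q ^ m - (-1) ^ m)" if "m > 0" for m
    using that by (simp add: fwt_def \<alpha>_def)
  \<comment> \<open>The first relation closes the two-step inductions, the other two are the start
    values at m = 1.\<close>
  have \<gamma>\<alpha>: "\<gamma> * (q\<^sup>2 - 1) = - 2 * \<alpha> * q" "\<alpha> * q - \<gamma> * (q + 1) = q" "\<alpha> + \<gamma> * (q + 1) = - 1"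
    using q1 by (simp_all add: \<alpha>_def \<gamma>_def divide_simps) (simp_all add: algebra_simps power2_eq_square)
  have A: "(\<Sum>j\<in>odds m. q ^ j * fwt q (m - j)) = q ^ m * (\<alpha> * of_nat m - \<gamma>) + \<gamma> * (-1) ^ m" for m
  proof (induction m rule: induct_nat_012)
    case 0
    show ?case by (subst sum_odds_0) simp
  next
    case 1
    show ?case using \<gamma>\<alpha>(2) by (simp add: fwt_def algebra_simps)
  next
    case (ge2 m)
    have "(\<Sum>j\<in>odds (Suc (Suc m)). q ^ j * fwt q (Suc (Suc m) - j)) =
        q * fwt q (Suc m) + q\<^sup>2 * (\<Sum>j\<in>odds m. q ^ j * fwt q (m - j))"
      unfolding sum_odds_Suc_Suc by (simp add: sum_distrib_left power2_eq_square mult_ac)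
    also have "\<dots> = q ^ Suc (Suc m) * (\<alpha> * of_nat (Suc (Suc m)) - \<gamma>) + \<gamma> * (-1) ^ Suc (Suc m)
       + (\<gamma> * (q\<^sup>2 - 1) + 2 * \<alpha> * q) * (-1) ^ m"
      unfolding ge2 by (simp add: f algebra_simps power2_eq_square)
    finally show ?case unfolding \<gamma>\<alpha>(1) by simp
  qed
  have B: "(\<Sum>j\<in>odds m. fwt q (m - j)) = \<alpha> * of_nat m * (-1) ^ m + \<gamma> * (-1) ^ m - \<gamma> * q ^ m" for m
  proof (induction m rule: induct_nat_012)
    case 0
    show ?case by (subst sum_odds_0) simp
  next
    case 1
    show ?case using \<gamma>\<alpha>(3) by (simp add: fwt_def algebra_simps)
  next
    case (ge2 m)
    have "(\<Sum>j\<in>odds (Suc (Suc m)). fwt q (Suc (Suc m) - j)) =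
        fwt q (Suc m) + (\<Sum>j\<in>odds m. fwt q (m - j))"
      unfolding sum_odds_Suc_Suc by simp
    also have "\<dots> = \<alpha> * of_nat (Suc (Suc m)) * (-1) ^ Suc (Suc m) + \<gamma> * (-1) ^ Suc (Suc m)
       - \<gamma> * q ^ Suc (Suc m) + (\<gamma> * (q\<^sup>2 - 1) + 2 * \<alpha> * q) * q ^ m"
      unfolding ge2 by (simp add: f algebra_simps power2_eq_square)
    finally show ?case unfolding \<gamma>\<alpha>(1) by simp
  qed
  have "(\<Sum>j\<in>odds m. 2 * ?a j / of_nat j * ?d (int m - int j)) = of_nat m * ?d (int m)" for m
  proof -
    have "(\<Sum>j\<in>odds m. 2 * ?a j / of_nat j * ?d (int m - int j)) =
      (\<Sum>j\<in>odds m. 2 * (q ^ j * fwt q (m - j) - fwt q (m - j)))"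
    proof (intro sum.cong refl)
      fix j assume j: "j \<in> odds m"
      then have "j > 0" by (auto elim: oddE)
      moreover have "nat (int m - int j) = m - j" by simp
      moreover have "2 * ?a j / of_nat j = 2 * (q ^ j - 1)" using \<open>j > 0\<close> by (simp add: gderiv_def)
      ultimately show "2 * ?a j / of_nat j * ?d (int m - int j) = 2 * (q ^ j * fwt q (m - j) - fwt q (m - j))"
        using j by (simp only:) (simp add: algebra_simps)
    qed
    also have "\<dots> = of_nat m * ?d (int m)"
      unfolding sum_distrib_left [symmetric] sum_subtractf A B
      by (cases "m = 0") (simp_all add: f algebra_simps)
    finally show ?thesis .
  qed
  then show ?thesis by (simp add: flow_coeff_def fwt_def)
qed

subsection \<open>The operators \<open>Q\<^sub>n\<close>\<close>

lemma const_sum: "const (sum f A) = (\<Sum>x\<in>A. const (f x))"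
  by (induction A rule: infinite_finite_induct) (simp_all add: const_add)

abbreviation X :: "int \<Rightarrow> gam" where
  "X \<equiv> wave (\<lambda>_. 1)"

lemma raising_nth: "raising $ n = X (int n)"
  by (simp add: raising_def wave_def cong: if_cong)

abbreviation Y :: "int \<Rightarrow> gam \<Rightarrow> gam" where
  "Y \<equiv> flow (\<lambda>j. - of_nat j)"

lemma pdiff_uminus: "pdiff n (- f) = - pdiff n f"
  using pdiff_const_mult [of n "-1" f] by (simp add: const_uminus)

text \<open>\<open>lowering\<close> sums the powers of an operator A divided by factorials, the flow
  is given by a recursion. Applying w d/dw to A^k / k! connects them.\<close>

lemma lowering_nth: "lowering f $ m = Y (int m) f"
proof -
  define L where "L k n = (if n < 0 then 0 else ((lower_log ^^ k) (fps_const f)) $ nat n)" for k and n :: int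
  have L_neg: "L k n = 0" if "n < 0" for k n using that by (simp add: L_def)
  have L_0: "L 0 n = (if n = 0 then f else 0)" for n
    by (auto simp: L_def)
  have L_Suc: "L (Suc k) n = - (\<Sum>j\<in>odds N. pdiff j (L k (n - int j)))" if "n \<le> int N" for k n N
  proof (cases "n < 0")
    case False
    have "L (Suc k) n = - (\<Sum>j\<in>odds (nat n). pdiff j (L k (n - int j)))"
      using False by (auto simp: L_def lower_log_def nat_diff_distrib intro!: sum.cong)
    also have "(\<Sum>j\<in>odds (nat n). pdiff j (L k (n - int j))) = (\<Sum>j\<in>odds N. pdiff j (L k (n - int j)))"
      using False that by (intro sum.mono_neutral_left ballI) (auto simp: L_def)
    finally show ?thesis .
  qed (simp add: L_neg)
  \<comment> \<open>Each application of A raises the order in w, so the sum over k may be cut off at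
    any bound above the degree.\<close>
  have L_small: "L k n = 0" if "n < int k" for k n
    using that
  proof (induction k arbitrary: n)
    case (Suc k)
    have "L k (n - int j) = 0" if "odd j" for j
      using odd_pos [OF that] Suc.prems by (intro Suc.IH) simp
    then show ?case by (subst L_Suc [of _ "nat n"]) (simp_all add: sum.neutral)
  qed (simp add: L_neg)
  \<comment> \<open>This is w d/dw A^(k+1) = (k+1) (w A') A^k; it holds because the coefficients of
    A commute.\<close>
  have L_deriv: "const (of_int n) * L (Suc k) n =
      const (of_nat (Suc k)) * (\<Sum>j\<in>odds N. const (- of_nat j) * pdiff j (L k (n - int j)))"
    if "n \<le> int N" for k n N
    using that
  proof (induction k arbitrary: n)
    case 0
    show ?case unfolding L_Suc [OF 0] L_0
      by (auto simp: sum_distrib_left const_uminus sum_negf [symmetric] intro!: sum.cong)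
  next
    case (Suc k)
    have "const (of_int n) * L (Suc (Suc k)) n =
        - (\<Sum>j\<in>odds N. pdiff j (const (of_int (n - int j)) * L (Suc k) (n - int j)))
        + (\<Sum>j\<in>odds N. const (- of_nat j) * pdiff j (L (Suc k) (n - int j)))"
    proof -
      have "const (of_int n) * - pdiff j z = - pdiff j (const (of_int (n - int j)) * z) + const (- of_nat j) * pdiff j z" for j z
        unfolding pdiff_const_mult by (simp add: const_diff const_uminus algebra_simps)
      then show ?thesis unfolding L_Suc [OF Suc.prems, of "Suc k"] sum_negf [symmetric] sum_distrib_left
          sum.distrib [symmetric] by (intro sum.cong refl) blast
    qed
    also have "(\<Sum>j\<in>odds N. pdiff j (const (of_int (n - int j)) * L (Suc k) (n - int j))) =
      const (of_nat (Suc k)) * (\<Sum>j\<in>odds N. \<Sum>i\<in>odds N. const (- of_nat i) * pdiff i (pdiff j (L k (n - int i - int j))))"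
      unfolding sum_distrib_left
    proof (intro sum.cong refl)
      fix j assume "j \<in> odds N"
      have "n - int j \<le> int N" "n - int j - int i = n - int i - int j" for i using Suc.prems by simp_all
      then show "pdiff j (const (of_int (n - int j)) * L (Suc k) (n - int j)) = 
         (\<Sum>i\<in>odds N. const (of_nat (Suc k)) * (const (- of_nat i) * pdiff i (pdiff j (L k (n - int i - int j)))))"
        by (simp only: Suc.IH pdiff_const_mult pdiff_sum pdiff_commute [of j] sum_distrib_left)
    qed
    also have "(\<Sum>j\<in>odds N. \<Sum>i\<in>odds N. const (- of_nat i) * pdiff i (pdiff j (L k (n - int i - int j))))
       = - (\<Sum>i\<in>odds N. const (- of_nat i) * pdiff i (L (Suc k) (n - int i)))"
    proof (subst sum.swap, unfold sum_negf [symmetric], intro sum.cong refl)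
      fix i assume "i \<in> odds N"
      have "n - int i \<le> int N" using Suc.prems by simp
      then show "(\<Sum>j\<in>odds N. const (- of_nat i) * pdiff i (pdiff j (L k (n - int i - int j)))) =
          - (const (- of_nat i) * pdiff i (L (Suc k) (n - int i)))"
        by (subst L_Suc) (simp_all add: pdiff_sum pdiff_uminus sum_distrib_left const_uminus sum_negf)
    qed
    also have "- (const (of_nat (Suc k)) * - S) + S = const (of_nat (Suc (Suc k))) * S" for S
      unfolding of_nat_Suc [of "Suc k"] const_add const_1 by (simp add: distrib_right del: of_nat_Suc)
    finally show ?case .
  qed
  define F where "F m = (\<Sum>k\<le>nat m. const (1 / fact k) * L k m)" for m
  have F: "F m = (\<Sum>k\<le>K. const (1 / fact k) * L k m)" if "m \<le> int K" for m K
    unfolding F_def using that by (intro sum.mono_neutral_left) (auto intro!: L_small)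
  have "F m = Y m f" for m
  proof (rule flow_unique)
    fix m :: int assume m: "m > 0"
    then obtain K where K: "m = int (Suc K)" by (metis zero_less_imp_eq_int gr0_conv_Suc)
    have "const (of_int m) * F m = (\<Sum>k\<le>Suc K. const (1 / fact k) * (const (of_int m) * L k m))"
      unfolding F [OF eq_refl [OF K]] sum_distrib_left by (intro sum.cong refl mult.left_commute)
    also have "\<dots> = (\<Sum>k\<le>K. const (1 / fact (Suc k)) * (const (of_int m) * L (Suc k) m))"
      using m by (subst sum.atMost_Suc_shift) (simp add: L_0)
    also have "\<dots> = (\<Sum>k\<le>K. \<Sum>j\<in>odds (nat m). const (- of_nat j) * pdiff j (const (1 / fact k) * L k (m - int j)))"
    proof (intro sum.cong refl)
      fix k
      have "(1 / fact (Suc k) :: ratfun) * of_nat (Suc k) = 1 / fact k"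
        by (simp del: of_nat_Suc)
      then have *: "const (1 / fact (Suc k)) * (const (of_nat (Suc k)) * S) = const (1 / fact k) * S" for S
        by (simp only: mult.assoc [symmetric] const_mult [symmetric])
      have "m \<le> int (nat m)" by simp
      show "const (1 / fact (Suc k)) * (const (of_int m) * L (Suc k) m) =
          (\<Sum>j\<in>odds (nat m). const (- of_nat j) * pdiff j (const (1 / fact k) * L k (m - int j)))"
        unfolding L_deriv [OF \<open>m \<le> int (nat m)\<close>] * pdiff_const_mult sum_distrib_left
        by (intro sum.cong refl mult.left_commute)
    qed
    also have "\<dots> = (\<Sum>j\<in>odds (nat m). const (- of_nat j) * pdiff j (\<Sum>k\<le>K. const (1 / fact k) * L k (m - int j)))"
      by (subst sum.swap) (simp add: pdiff_sum sum_distrib_left)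
    also have "\<dots> = (\<Sum>j\<in>odds (nat m). const (- of_nat j) * pdiff j (F (m - int j)))"
      by (intro sum.cong refl arg_cong2 [where f = "(*)"] arg_cong2 [where f = pdiff] F [symmetric])
        (auto simp: K elim!: oddE)
    finally show "const (of_int m) * F m = \<dots>" .
  qed (auto simp: F_def L_neg L_0)
  moreover have "lowering f $ m = F (int m)"
    by (simp add: lowering_def F_def L_def)
  ultimately show ?thesis by simp
qed

lemma flow_psum:
  assumes "odd k"
  shows "flow a m (psum k) = (if m = 0 then psum k else if m = int k then const (a k / of_nat k) else 0)"
proof (rule flow_unique [symmetric])
  fix m :: int assume m: "m > 0"
  have k: "k > 0" using assms by (rule odd_pos)
  have "(\<Sum>j\<in>odds (nat m). const (a j) * pdiff j (if m - int j = 0 then psum k else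
      if m - int j = int k then const (a k / of_nat k) else 0))
    = (\<Sum>j\<in>odds (nat m). if k = j then if m = int k then const (a k) else 0 else 0)"
    using assms by (intro sum.cong refl) (auto simp: pdiff_psum)
  also have "\<dots> = (if m = int k then const (a k) else 0)"
    using assms by (subst sum.delta') auto
  also have "\<dots> = const (of_int m) * (if m = 0 then psum k else if m = int k then const (a k / of_nat k) else 0)"
    using m k by (auto simp: const_mult [symmetric])
  finally show "const (of_int m) * (if m = 0 then psum k else if m = int k then const (a k / of_nat k) else 0) =
    (\<Sum>j\<in>odds (nat m). const (a j) * pdiff j (if m - int j = 0 then psum k else
      if m - int j = int k then const (a k / of_nat k) else 0))" by simp
qed auto

text \<open>The flow substitutes p_k + (a_k / k) u^k for p_k, so only the powers 0 and k of u occur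
  on the generator itself.\<close>

lemma flow_psum_mult:
  assumes "odd k"
  shows "flow a m (psum k * f) = psum k * flow a m f + const (a k / of_nat k) * flow a (m - int k) f"
proof -
  have k: "k > 0" using assms by (rule odd_pos)
  define M where "M = max m (int k)"
  have "flow a m (psum k * f) = (\<Sum>i\<in>{0..M}. flow a i (psum k) * flow a (m - i) f)"
    by (rule flow_mult) (simp add: M_def)
  also have "\<dots> = (\<Sum>i\<in>{0, int k}. flow a i (psum k) * flow a (m - i) f)"
    using assms by (intro sum.mono_neutral_right) (auto simp: M_def flow_psum)
  also have "\<dots> = psum k * flow a m f + const (a k / of_nat k) * flow a (m - int k) f"
    using k assms by (simp add: flow_psum)
  finally show ?thesis .
qed

text \<open>The substitution turns a polynomial in the p_j into a polynomial in u.\<close>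

lemma flow_eventually_0: "\<exists>M\<ge>0. \<forall>m>M. flow a m f = 0"
proof (induction f rule: gam_induct)
  case (const c)
  then show ?case by (intro exI [of _ 0]) (auto simp: flow_const)
next
  case (mult j f)
  then obtain M where "M \<ge> 0" "\<forall>m>M. flow a m f = 0" by blast
  then show ?case using mult(1) by (intro exI [of _ "M + int j"]) (auto simp: flow_psum_mult)
next
  case (add f g)
  then obtain M M' where "M \<ge> 0" "\<forall>m>M. flow a m f = 0" "\<forall>m>M'. flow a m g = 0" by blast
  then show ?case by (intro exI [of _ "max M M'"]) (auto simp: flow_add)
qed

text \<open>Replaces the support of f in the definition by a fixed range, on which sums for
  different arguments can be compared.\<close>

lemma Qop_eq:
  assumes "\<And>m. m > M \<Longrightarrow> Y m f = 0"
  shows "Qop n f = (\<Sum>m\<in>{0..M}. X (n + m) * Y m f)"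
proof -
  have "Qop n f = (\<Sum>m | n + int m \<ge> 0 \<and> Y (int m) f \<noteq> 0. X (n + int m) * Y (int m) f)"
    unfolding Qop_def lowering_nth raising_nth by (intro sum.cong refl) auto
  also have "\<dots> = (\<Sum>m\<in>int ` {m. n + int m \<ge> 0 \<and> Y (int m) f \<noteq> 0}. X (n + m) * Y m f)"
    by (simp add: sum.reindex)
  also have "\<dots> = (\<Sum>m\<in>{0..M}. X (n + m) * Y m f)"
  proof (intro sum.mono_neutral_left ballI)
    show "int ` {m. n + int m \<ge> 0 \<and> Y (int m) f \<noteq> 0} \<subseteq> {0..M}"
    proof clarify
      fix m assume "Y (int m) f \<noteq> 0"
      then have "\<not> int m > M" using assms by blast
      then show "int m \<in> {0..M}" by simp
    qed
  next
    fix m assume m: "m \<in> {0..M} - int ` {m. n + int m \<ge> 0 \<and> Y (int m) f \<noteq> 0}"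
    show "X (n + m) * Y m f = 0"
    proof (rule ccontr)
      assume "X (n + m) * Y m f \<noteq> 0"
      then have "n + m \<ge> 0" "Y m f \<noteq> 0" by (auto simp: wave_def split: if_splits)
      with m have "m \<in> int ` {m. n + int m \<ge> 0 \<and> Y (int m) f \<noteq> 0}"
        by (intro image_eqI [of _ _ "nat m"]) simp_all
      with m show False by blast
    qed
  qed simp
  finally show ?thesis .
qed

lemma Qop_linear:
  shows Qop_add: "Qop n (f + g) = Qop n f + Qop n g"
    and Qop_const_mult: "Qop n (const c * f) = const c * Qop n f"
proof -
  obtain M where M: "\<And>m. m > M \<Longrightarrow> Y m f = 0" using flow_eventually_0 by blast
  obtain N where N: "\<And>m. m > N \<Longrightarrow> Y m g = 0" using flow_eventually_0 by blast
  show "Qop n (f + g) = Qop n f + Qop n g"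
    by (subst (1 2 3) Qop_eq [where M = "max M N"])
      (simp_all add: M N flow_add distrib_left sum.distrib)
  show "Qop n (const c * f) = const c * Qop n f"
    by (subst (1 2) Qop_eq [where M = M])
      (simp_all add: M flow_const_mult sum_distrib_left mult.left_commute)
qed

lemma Qop_0 [simp]: "Qop n 0 = 0"
  using Qop_const_mult [of n 0 0] by simp

lemma Qop_uminus: "Qop n (- f) = - Qop n f"
  using Qop_const_mult [of n "-1" f] by (simp add: const_uminus)

lemma Qop_diff: "Qop n (f - g) = Qop n f - Qop n g"
  using Qop_add [of n f "- g"] by (simp add: Qop_uminus)

lemma Qop_sum: "Qop n (sum f A) = (\<Sum>x\<in>A. Qop n (f x))"
  by (induction A rule: infinite_finite_induct) (auto simp: Qop_add)

lemma Qop_const: "Qop n (const c) = const c * X n"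
  by (subst Qop_eq [where M = 0]) (simp_all add: flow_const)

lemma Qop_1: "Qop n 1 = X n"
  using Qop_const [of n 1] by simp

text \<open>The lowering exponential substitutes p_k - z^(-k) for p_k, and the raising one is a
  multiplication, so Q(z) p_k = (p_k - z^(-k)) Q(z).\<close>

lemma Qop_psum_mult:
  assumes "odd k"
  shows "Qop n (psum k * f) = psum k * Qop n f - Qop (n + int k) f"
proof -
  obtain M where M: "\<And>m. m > M \<Longrightarrow> Y m f = 0" using flow_eventually_0 by blast
  define N where "N = M + int k"
  have Y: "Y m (psum k * f) = psum k * Y m f - Y (m - int k) f" for m
    using odd_pos [OF assms] by (simp add: flow_psum_mult [OF assms] const_uminus)
  have "(\<Sum>m\<in>{0..N}. X (n + m) * Y (m - int k) f) = (\<Sum>m\<in>{0..N}. X (n + int k + m) * Y m f)"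
    using sum_int_shift [where j = "int k" and M = N and \<phi> = "\<lambda>m. X (n + int k + m) * Y m f"] M
    by (simp add: N_def)
  then show ?thesis
    by (subst (1 2 3) Qop_eq [where M = N])
      (simp_all add: N_def M Y right_diff_distrib sum_subtractf sum_distrib_left mult.left_commute)
qed

text \<open>The coefficients of \<open>(1 - x) / (1 + x)\<close>.\<close>

definition qcoeff :: "int \<Rightarrow> ratfun" where
  "qcoeff m = (if m < 0 then 0 else if m = 0 then 1 else 2 * (-1) ^ nat m)"

lemma Y_X: "Y m (X n) = const (qcoeff m) * X (n - m)"
  using flow_wave [OF flow_coeff_lowering] by (simp add: qcoeff_def)

text \<open>The range depends only on m + n, so the sum with m and n exchanged can be added
  termwise.\<close>

lemma Qop_X: "Qop m (X n) = (\<Sum>i\<in>{0..m + n}. const (qcoeff (n - i)) * X i * X (m + n - i))"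
proof -
  have "Qop m (X n) = (\<Sum>a\<in>{0..max n 0}. X (m + a) * (const (qcoeff a) * X (n - a)))"
    by (subst Qop_eq [where M = "max n 0"]) (simp_all add: Y_X)
  also have "\<dots> = (\<Sum>i\<in>{n - max n 0..n}. const (qcoeff (n - i)) * X i * X (m + n - i))"
    by (rule sum.reindex_bij_witness [of _ "\<lambda>i. n - i" "\<lambda>a. n - a"]) (auto simp: mult_ac)
  also have "\<dots> = (\<Sum>i\<in>{min 0 (n - max n 0)..max n (m + n)}. const (qcoeff (n - i)) * X i * X (m + n - i))"
    by (intro sum.mono_neutral_left) (auto simp: qcoeff_def)
  also have "\<dots> = (\<Sum>i\<in>{0..m + n}. const (qcoeff (n - i)) * X i * X (m + n - i))"
    by (intro sum.mono_neutral_right) auto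
  finally show ?thesis .
qed

definition altsign :: "int \<Rightarrow> ratfun" where
  "altsign i = (if even i then 1 else - 1)"

lemma qcoeff_altsign: "qcoeff m = (if m < 0 then 0 else if m = 0 then 1 else 2 * altsign m)"
proof (cases "m < 0")
  case False
  then obtain k where "m = int k" by (metis nonneg_int_cases not_less)
  then show ?thesis by (simp add: qcoeff_def altsign_def minus_one_power_iff)
qed (simp add: qcoeff_def)

text \<open>This is \<open>X(z) X(-z) = 1\<close>.\<close>

lemma altsign_X_X: 
  assumes "s > 0"
  shows "(\<Sum>i\<in>{0..s}. const (altsign i) * X i * X (s - i)) = 0"
proof -
  let ?U = "\<Sum>i\<in>{0..s}. const (altsign i) * X i * X (s - i)" and ?N = "nat s"
  have "const (of_int s) * ?U = (\<Sum>i\<in>{0..s}. const (altsign i) * ((const (of_int i) * X i) * X (s - i)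
      + X i * (const (of_int (s - i)) * X (s - i))))"
    unfolding sum_distrib_left by (intro sum.cong refl) (simp add: const_diff algebra_simps)
  also have "\<dots> = (\<Sum>i\<in>{0..s}. \<Sum>j\<in>odds ?N. const 2 * psum j * (const (altsign i) * X (i - int j) * X (s - i)
      + const (altsign i) * X i * X (s - int j - i)))"
  proof (intro sum.cong refl)
    fix i assume "i \<in> {0..s}"
    then have "i \<le> int ?N" "s - i \<le> int ?N" by auto
    then show "const (altsign i) * ((const (of_int i) * X i) * X (s - i) + X i * (const (of_int (s - i)) * X (s - i)))
      = (\<Sum>j\<in>odds ?N. const 2 * psum j * (const (altsign i) * X (i - int j) * X (s - i)
      + const (altsign i) * X i * X (s - int j - i)))"
      by (simp only: wave_rec [of _ ?N])
        (simp add: sum_distrib_left sum_distrib_right sum.distrib [symmetric] algebra_simps)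
  qed
  also have "\<dots> = (\<Sum>j\<in>odds ?N. const 2 * psum j * ((\<Sum>i\<in>{0..s}. const (altsign i) * X (i - int j) * X (s - i))
      + (\<Sum>i\<in>{0..s}. const (altsign i) * X i * X (s - int j - i))))"
    by (subst sum.swap) (simp only: sum_distrib_left sum.distrib [symmetric])
  also have "\<dots> = 0"
  proof (intro sum.neutral ballI)
    fix j assume j: "j \<in> odds ?N"
    \<comment> \<open>An odd shift of the index changes the sign, so the two sums cancel for each
      j.\<close>
    have "(\<Sum>i\<in>{0..s}. const (altsign i) * X (i - int j) * X (s - i)) =
        - (\<Sum>i\<in>{0..s}. const (altsign (i - int j)) * X (i - int j) * X (s - int j - (i - int j)))"
      unfolding sum_negf [symmetric]
      using j by (intro sum.cong refl) (auto simp: altsign_def const_uminus)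
    also have "\<dots> = - (\<Sum>i\<in>{0..s}. const (altsign i) * X i * X (s - int j - i))"
      by (subst sum_int_shift) auto
    finally show "const 2 * psum j * ((\<Sum>i\<in>{0..s}. const (altsign i) * X (i - int j) * X (s - i))
      + (\<Sum>i\<in>{0..s}. const (altsign i) * X i * X (s - int j - i))) = 0" by simp
  qed
  finally have "const (of_int s) * ?U = const (of_int s) * 0" by simp
  then show ?thesis by (rule const_mult_left_cancel) (use assms in simp)
qed

text \<open>On constants this reduces to X(z) X(-z) = 1. Passing a factor \<open>psum k\<close> only
  raises one of the indices, so m + n > 0 is preserved in the induction.\<close>

lemma Qop_anticommute:
  assumes "m + n > 0"
  shows "Qop m (Qop n f) + Qop n (Qop m f) = 0"
  using assms
proof (induction f arbitrary: m n rule: gam_induct)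
  case (const c)
  \<comment> \<open>The coefficients of (1 - x) / (1 + x) at k and -k add up to 2 (-1)^k; at k = 0
    both are 1.\<close>
  have q: "qcoeff (n - i) + qcoeff (i - n) = 2 * altsign n * altsign i" for i
  proof -
    have "qcoeff (n - i) + qcoeff (i - n) = 2 * altsign (n - i)"
      unfolding qcoeff_altsign by (cases n i rule: linorder_cases) (simp_all add: altsign_def)
    then show ?thesis by (simp add: altsign_def)
  qed
  have "Qop n (X m) = (\<Sum>i\<in>{0..m + n}. const (qcoeff (i - n)) * X i * X (m + n - i))"
    unfolding Qop_X by (rule sum.reindex_bij_witness [of _ "\<lambda>i. m + n - i" "\<lambda>i. m + n - i"])
      (auto simp: mult_ac add.commute [of m n])
  then have "Qop m (X n) + Qop n (X m) =
      (\<Sum>i\<in>{0..m + n}. const (qcoeff (n - i) + qcoeff (i - n)) * X i * X (m + n - i))"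
    by (simp add: Qop_X sum.distrib [symmetric] const_add distrib_right)
  also have "\<dots> = const (2 * altsign n) * (\<Sum>i\<in>{0..m + n}. const (altsign i) * X i * X (m + n - i))"
    unfolding q by (simp add: const_mult sum_distrib_left mult_ac)
  also have "\<dots> = 0" using const.prems by (simp add: altsign_X_X)
  finally show ?case
    by (simp add: Qop_const Qop_const_mult distrib_left [symmetric])
next
  case (mult k f)
  have "Qop m (Qop n (psum k * f)) + Qop n (Qop m (psum k * f)) =
      psum k * (Qop m (Qop n f) + Qop n (Qop m f))
      - (Qop (m + int k) (Qop n f) + Qop n (Qop (m + int k) f))
      - (Qop m (Qop (n + int k) f) + Qop (n + int k) (Qop m f))"
    using mult(1) by (simp add: Qop_psum_mult Qop_diff right_diff_distrib distrib_left)
  also have "\<dots> = 0" using mult by simp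
  finally show ?case .
next
  case (add f g)
  have "Qop m (Qop n (f + g)) + Qop n (Qop m (f + g)) =
    (Qop m (Qop n f) + Qop n (Qop m f)) + (Qop m (Qop n g) + Qop n (Qop m g))"
    by (simp add: Qop_add)
  then show ?case using add by simp
qed

lemma Qop_square: 
  assumes "n > 0"
  shows "Qop n (Qop n f) = 0"
proof -
  have "const (1 + 1) * Qop n (Qop n f) = const (1 + 1) * 0"
    using Qop_anticommute [of n n f] assms by (simp only: const_add distrib_right const_1) simp
  then show ?thesis by (rule const_mult_left_cancel) simp
qed

lemma Qop_swap: "m + n > 0 \<Longrightarrow> Qop m (Qop n f) = - Qop n (Qop m f)"
  using Qop_anticommute [of m n f] by (simp add: eq_neg_iff_add_eq_0)

subsection \<open>The operators adjoint to multiplication by \<open>g\<^sub>n\<close>\<close>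

abbreviation E :: "int \<Rightarrow> gam \<Rightarrow> gam" where
  "E \<equiv> flow gderiv"

definition fcoeff :: "int \<Rightarrow> ratfun" where
  "fcoeff m = (if m < 0 then 0 else fwt q (nat m))"

text \<open>E(u) Q(z) = F(uz) Q(z) E(u): the flow is multiplicative, commutes with the lowering flow
  Y, and multiplies X(z) by F(uz).\<close>

lemma E_Qop:
  assumes "k \<le> K"
  shows "E k (Qop n f) = (\<Sum>i\<in>{0..K}. const (fcoeff i) * Qop (n - i) (E (k - i) f))"
proof -
  obtain M where M: "\<And>m. m > M \<Longrightarrow> Y m f = 0" using flow_eventually_0 by blast
  have M': "Y m (E i f) = 0" if "m > M" for m i
    using M [OF that] by (simp add: flow_commute [of _ m])
  have "E k (Qop n f) = (\<Sum>m\<in>{0..M}. E k (X (n + m) * Y m f))"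
    by (simp add: Qop_eq [OF M] flow_sum)
  also have "\<dots> = (\<Sum>m\<in>{0..M}. \<Sum>i\<in>{0..K}. const (fcoeff i) * X (n - i + m) * Y m (E (k - i) f))"
    unfolding flow_mult [OF assms] flow_wave [OF flow_coeff_fwt] fcoeff_def [symmetric]
      flow_commute [of gderiv _ "\<lambda>j. - of_nat j"]
    by (simp add: diff_add_eq)
  also have "\<dots> = (\<Sum>i\<in>{0..K}. const (fcoeff i) * Qop (n - i) (E (k - i) f))"
    by (subst sum.swap) (simp add: Qop_eq [OF M'] sum_distrib_left mult.assoc)
  finally show ?thesis .
qed

text \<open>Coefficients of (1 - (q-1) x - q x^2) F(x) = 1 + (q-1) x - q x^2.\<close>

lemma fcoeff_rec: "fcoeff i = (q - 1) * fcoeff (i - 1) + q * fcoeff (i - 2) +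
  (if i = 0 then 1 else if i = 1 then q - 1 else if i = 2 then - q else 0)"
proof -
  consider "i < 0" | "i = 0" | "i = 1" | "i = 2" | n where "i = int n + 3"
  proof (cases "i \<ge> 3")
    case True
    then have "i - 3 \<ge> 0" by simp
    then obtain n where "i - 3 = int n" by (rule nonneg_int_cases)
    then have "i = int n + 3" by simp
    then show ?thesis by (rule that(5))
  next
    case False
    then have "i < 0 \<or> i = 0 \<or> i = 1 \<or> i = 2" by linarith
    then show ?thesis using that(1-4) by blast
  qed
  then show ?thesis
  proof cases
    case (5 n)
    then have "nat i = n + 3" "nat (i - 1) = n + 2" "nat (i - 2) = n + 1" by auto
    moreover have "fwt q (Suc k) = 2 * (q - 1) / (q + 1) * (q ^ Suc k - (-1) ^ Suc k)" for k
      by (simp add: fwt_def)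
    ultimately show ?thesis
      using 5 by (simp add: fcoeff_def numeral_eq_Suc algebra_simps del: times_divide_eq_left times_divide_eq_right)
  qed (use q_plus_1_neq_0 in \<open>simp_all add: fcoeff_def fwt_def field_simps power2_eq_square\<close>)
qed

text \<open>Multiplying the commutation rule by the denominator of F leaves only the numerator terms
  i = 0, 1, 2 of the convolution.\<close>

lemma E_Qop_rec: "E k (Qop n f) = const (q - 1) * E (k - 1) (Qop (n - 1) f)
  + const q * E (k - 2) (Qop (n - 2) f)
  + Qop n (E k f) + const (q - 1) * Qop (n - 1) (E (k - 1) f) - const q * Qop (n - 2) (E (k - 2) f)"
proof -
  \<comment> \<open>At least 2, so that the three exceptional indices of \<open>fcoeff_rec\<close>
    lie in the range.\<close>
  define K where "K = max k 2"
  define T where "T i = Qop (n - i) (E (k - i) f)" for i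
  have T: "T i = 0" if "i > K" for i using that by (simp add: T_def K_def)
  have shift: "(\<Sum>i\<in>{0..K}. const (fcoeff i) * T (i + j)) = (\<Sum>i\<in>{0..K}. const (fcoeff (i - j)) * T i)" if "j \<ge> 0" for j
    using sum_int_shift [where j = j and M = K and \<phi> = "\<lambda>i. const (fcoeff i) * T (i + j)"] that T
    by (simp add: fcoeff_def)
  have E: "E (k - j) (Qop (n - j) f) = (\<Sum>i\<in>{0..K}. const (fcoeff (i - j)) * T i)" if "j \<ge> 0" for j
    unfolding shift [OF that, symmetric] using that
    by (subst E_Qop [where K = K]) (simp_all add: T_def K_def algebra_simps)
  have "E k (Qop n f) = (\<Sum>i\<in>{0..K}. const (fcoeff i) * T i)"
    using E [of 0] by simp
  also have "\<dots> = const (q - 1) * (\<Sum>i\<in>{0..K}. const (fcoeff (i - 1)) * T i)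
     + const q * (\<Sum>i\<in>{0..K}. const (fcoeff (i - 2)) * T i)
     + (\<Sum>i\<in>{0..K}. const (if i = 0 then 1 else if i = 1 then q - 1 else if i = 2 then - q else 0) * T i)"
    by (subst fcoeff_rec)
      (simp only: const_add const_mult distrib_right sum.distrib sum_distrib_left mult.assoc)
  also have "(\<Sum>i\<in>{0..K}. const (if i = 0 then 1 else if i = 1 then q - 1 else if i = 2 then - q else 0) * T i)
     = (\<Sum>i\<in>{0,1,2}. const (if i = 0 then 1 else if i = 1 then q - 1 else if i = 2 then - q else 0) * T i)"
    by (rule sum.mono_neutral_right) (auto simp: K_def)
  also have "\<dots> = T 0 + const (q - 1) * T 1 - const q * T 2"
    by (simp add: const_uminus)
  finally show ?thesis using E [of 1] E [of 2] by (simp add: T_def)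
qed

subsection \<open>The transfer matrix\<close>

text \<open>In a state \<open>(x, s, r, y)\<close> the components \<open>x\<close>, \<open>s\<close>, \<open>y\<close> are the weights accumulated so far for
  \<open>h = 0\<close>, \<open>h = 1\<close>, \<open>h = 2\<close>. The component \<open>r\<close> also belongs to \<open>h = 1\<close>: it is the weight after
  lengthening the bottom row of the current border strip by one square. Together \<open>s\<close> and \<open>r\<close>
  determine all further lengthenings, because \<open>f\<^bsub>i+2\<^esub> = (t - 1) f\<^bsub>i+1\<^esub> + t f\<^sub>i\<close> for \<open>i \<ge> 1\<close>. The two
  arguments of type \<open>bool\<close> say whether the current \<open>m\<close> is a part of \<open>\<lambda>\<close> and of \<open>\<nu>\<close>.\<close>

type_synonym 'a state = "'a \<times> 'a \<times> 'a \<times> 'a"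

fun step :: "'a::field \<Rightarrow> bool \<Rightarrow> bool \<Rightarrow> 'a state \<Rightarrow> 'a state" where
  "step t False False (x, s, r, y) = (x, r, (t - 1) * r + t * s, - t * y)"
| "step t True True (x, s, r, y) =
     (x, 2 * (t - 1) * s - r, (2 * (t - 1) * (t - 1) - t) * s - (t - 1) * r, - t * y)"
| "step t True False (x, s, r, y) = (0, 2 * (t - 1) * x, 2 * (t - 1) * (t - 1) * x, - t * s)"
| "step t False True (x, s, r, y) = (s, 2 * (t - 1) * y, 2 * (t - 1) * (t - 1) * y, 0)"

text \<open>At the end h is l(\<lambda>) - l(\<nu>), so the 2 is the Kronecker factor of the weight.
  The look-ahead component r is dropped.\<close>

fun final :: "'a::field state \<Rightarrow> 'a" where
  "final (x, s, r, y) = x + s + 2 * y"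

primrec scan :: "'a::field \<Rightarrow> nat \<Rightarrow> nat set \<Rightarrow> nat set \<Rightarrow> 'a state \<Rightarrow> 'a" where
  "scan t 0 L N s = final s"
| "scan t (Suc m) L N s = scan t m L N (step t (Suc m \<in> L) (Suc m \<in> N) s)"

text \<open>The combinatorial side of degree d: a sum over strict \<nu> with parts at most m, by
  whether m is a part of \<nu>. As the largest part, m contributes the outermost operator. L is the
  set of parts of \<lambda>.\<close>

primrec expand :: "nat \<Rightarrow> nat set \<Rightarrow> int \<Rightarrow> ratfun state \<Rightarrow> gam" where
  "expand 0 L d s = (if d = 0 then const (final s) else 0)"
| "expand (Suc m) L d s = expand m L d (step q (Suc m \<in> L) False s)
     + Qop (int (Suc m)) (expand m L (d - int (Suc m)) (step q (Suc m \<in> L) True s))"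

lemma expand_add: "expand m L d (x + x', s + s', r + r', y + y')
  = expand m L d (x, s, r, y) + expand m L d (x', s', r', y')"
proof (induction m arbitrary: d x s r y x' s' r' y')
  case 0
  then show ?case by (simp add: const_add [symmetric] algebra_simps)
next
  case (Suc m)
  have "step q l n (x + x', s + s', r + r', y + y') = (fst (step q l n (x, s, r, y)) + fst (step q l n (x', s', r', y')),
      fst (snd (step q l n (x, s, r, y))) + fst (snd (step q l n (x', s', r', y'))),
      fst (snd (snd (step q l n (x, s, r, y)))) + fst (snd (snd (step q l n (x', s', r', y')))),
      snd (snd (snd (step q l n (x, s, r, y)))) + snd (snd (snd (step q l n (x', s', r', y')))))" for l n
    by (cases l; cases n) (simp_all add: algebra_simps)
  then show ?case by (simp add: Suc Qop_add)
qed

lemma expand_mult: "expand m L d (k * x, k * s, k * r, k * y) = const k * expand m L d (x, s, r, y)"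
proof (induction m arbitrary: d x s r y)
  case 0
  then show ?case by (simp add: const_mult [symmetric] algebra_simps)
next
  case (Suc m)
  have "step q l n (k * x, k * s, k * r, k * y) = (k * fst (step q l n (x, s, r, y)),
      k * fst (snd (step q l n (x, s, r, y))), k * fst (snd (snd (step q l n (x, s, r, y)))),
      k * snd (snd (snd (step q l n (x, s, r, y)))))" for l n
    by (cases l; cases n) (simp_all add: algebra_simps)
  then show ?case by (simp add: Suc Qop_const_mult distrib_left)
qed

text \<open>Linearity in the state: recursions between expansions need only be compared on the four
  unit states.\<close>

lemma expand_basis: "expand m L d (x, s, r, y) = const x * expand m L d (1, 0, 0, 0)
   + const s * expand m L d (0, 1, 0, 0) + const r * expand m L d (0, 0, 1, 0) + const y * expand m L d (0, 0, 0, 1)"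
  unfolding expand_mult [symmetric] expand_add [symmetric] by simp

lemma expand_0 [simp]: "expand m L d (0, 0, 0, 0) = 0"
  using expand_mult [of m L d 0 0 0 0 0] by simp

lemma expand_cong:
  assumes "\<And>i. 1 \<le> i \<Longrightarrow> i \<le> m \<Longrightarrow> i \<in> L \<longleftrightarrow> i \<in> L'"
  shows "expand m L d s = expand m L' d s"
  using assms by (induction m arbitrary: d s) auto

text \<open>Above the parts of \<lambda> the state (1, 0, 0, 0) is fixed if m is not in \<nu> and
  killed if it is, since h would become -1.\<close>

lemma expand_extend:
  assumes "m \<le> m'" "\<And>i. m < i \<Longrightarrow> i \<notin> L"
  shows "expand m' L d (1, 0, 0, 0) = expand m L d (1, 0, 0, 0)"
  using assms
proof (induction m' rule: dec_induct)
  case (step k)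
  then show ?case by simp
qed simp

section \<open>The action of E on Schur's Q-functions\<close>

lemma strict_partition_Cons:
  "strict_partition (a # l) \<longleftrightarrow> a > 0 \<and> (\<forall>b\<in>set l. b < a) \<and> strict_partition l"
  by (auto simp: strict_partition_def)

lemma strict_partition_Nil [simp]: "strict_partition []"
  by (simp add: strict_partition_def)

lemma schurQ_Nil [simp]: "schurQ [] = 1" and schurQ_Cons: "schurQ (a # l) = Qop (int a) (schurQ l)"
  by (simp_all add: schurQ_def)

lemma const_numeral [simp]: "const (numeral n) = numeral n"
  by (simp add: const_def)

lemma E_one: "E k 1 = (if k = 0 then 1 else 0)"
  using flow_const [of gderiv k 1] by simp


text \<open>Mirrors \<open>E_Qop_rec\<close>. The conditionals come from \<open>Q\<^sub>b Q\<^sub>b = 0\<close> and \<open>Q\<^sub>b Q\<^sub>c = - Q\<^sub>c Q\<^sub>b\<close>, applied when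
  the lowered largest part meets or passes the next part.\<close>

lemma expand_rec:
  fixes m L d
  defines "b1 \<equiv> Suc (Suc m) \<in> L" and "b2 \<equiv> Suc m \<in> L"
  assumes L: "\<And>i. i \<in> L \<Longrightarrow> i \<le> Suc (Suc m)"
  shows "expand (Suc (Suc (Suc m))) (insert (Suc (Suc (Suc m))) L) d (1, 0, 0, 0) =
     const (q - 1) * (if b1 then 0 else expand (Suc (Suc m)) (insert (Suc (Suc m)) L) d (1, 0, 0, 0))
   + const q * (if b2 then 0 else (if b1 then - 1 else 1) * expand (Suc (Suc m)) (insert (Suc m) L) d (1, 0, 0, 0))
   + Qop (int (Suc (Suc (Suc m)))) (expand (Suc (Suc m)) L (d - int (Suc (Suc (Suc m)))) (1, 0, 0, 0))
   + const (q - 1) * Qop (int (Suc (Suc m))) (expand (Suc (Suc m)) L (d - int (Suc (Suc m))) (1, 0, 0, 0))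
   - const q * Qop (int (Suc m)) (expand (Suc (Suc m)) L (d - int (Suc m)) (1, 0, 0, 0))"
proof -
  have [simp]: "expand m (insert (Suc (Suc (Suc m))) L) = expand m L"
    "expand m (insert (Suc (Suc m)) L) = expand m L"
    "expand m (insert (Suc m) L) = expand m L"
    by (intro ext expand_cong; auto)+
  have [simp]: "Suc (Suc (Suc m)) \<notin> L" using L by fastforce
  define Q1 where "Q1 = Qop (int (Suc m))"
  define Q2 where "Q2 = Qop (int (Suc (Suc m)))"
  define Q3 where "Q3 = Qop (int (Suc (Suc (Suc m))))"
  note Q_defs = Q1_def [symmetric] Q2_def [symmetric] Q3_def [symmetric]
  have lin: "Q (f + g) = Q f + Q g" "Q (const c * f) = const c * Q f" "Q (- f) = - Q f" "Q 0 = 0"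
    "Q (f - g) = Q f - Q g" "Q (numeral k * f) = numeral k * Q f"
     if "Q \<in> {Q1, Q2, Q3}" for Q f g c k
    using that by (auto simp: Q1_def Q2_def Q3_def Qop_add Qop_const_mult Qop_uminus Qop_diff
        Qop_const_mult [of _ "numeral k", simplified])
  note lin = lin [of Q1, simplified] lin [of Q2, simplified] lin [of Q3, simplified]
  \<comment> \<open>Brings products to decreasing index order. \<open>Q3\<close> only ever stands
    outermost, so it needs no rule.\<close>
  have comm: "Q1 (Q2 f) = - Q2 (Q1 f)" "Q1 (Q1 f) = 0" "Q2 (Q2 f) = 0" for f
    by (auto simp: Q1_def Q2_def Qop_square intro!: Qop_swap)
  note const_simps = const_mult const_add const_diff const_uminus
  \<comment> \<open>With the top levels unfolded, both sides are combinations of these unit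
    expansions at shifted degrees. The four cases of b1 and b2 become polynomial identities in
    q.\<close>
  define e where "e d i = expand m L d (if i = 0 then (1,0,0,0) else if i = 1 then (0,1,0,0) else if i = 2 then (0,0,1,0) else (0,0,0,1))" for d :: int and i :: nat
  have ebasis: "expand m L d (x, s, r, y) = const x * e d 0 + const s * e d 1 + const r * e d 2 + const y * e d 3" for d x s r y
    by (subst expand_basis) (simp add: e_def)
  define d1 where "d1 = int (Suc m)"
  define d2 where "d2 = int (Suc (Suc m))"
  define d3 where "d3 = int (Suc (Suc (Suc m)))"
  note d_defs = d1_def [symmetric] d2_def [symmetric] d3_def [symmetric]
  show ?thesis
    unfolding expand.simps unfolding Q_defs unfolding d_defs
    by (cases b1; cases b2; simp add: b1_def b2_def ebasis lin comm const_simps algebra_simps)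
qed

text \<open>Degrees are written as total size minus d, so that d is the size of the remaining \<nu>,
  as in \<open>expand\<close>.\<close>

lemma E_schurQ_Cons:
  "E (int (sum_list (a # l)) - d) (schurQ (a # l)) =
     const (q - 1) * E (int (sum_list (a # l)) - d - 1) (Qop (int a - 1) (schurQ l))
   + const q * E (int (sum_list (a # l)) - d - 2) (Qop (int a - 2) (schurQ l))
   + Qop (int a) (E (int (sum_list l) - (d - int a)) (schurQ l))
   + const (q - 1) * Qop (int a - 1) (E (int (sum_list l) - (d - (int a - 1))) (schurQ l))
   - const q * Qop (int a - 2) (E (int (sum_list l) - (d - (int a - 2))) (schurQ l))"
  unfolding schurQ_Cons by (subst E_Qop_rec) (simp add: algebra_simps)

lemma Qop_numeral: "Qop n (numeral k) = numeral k * X n"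
  using Qop_const [of n "numeral k"] by simp

lemma flow_uminus: "flow a m (- f) = - flow a m f"
  using flow_const_mult [of a m "-1" f] by (simp add: const_uminus)

lemma strict_partition_max:
  assumes "strict_partition l" "\<And>b. b \<in> set l \<Longrightarrow> b \<le> m" "m \<in> set l"
  obtains l' where "l = m # l'"
  using assms by (cases l) (fastforce simp: strict_partition_Cons)+

text \<open>Strong induction on the size of \<lambda>: the operator recursion lowers the largest
  part by 1 or 2 or removes it, and \<open>expand_rec\<close> is the same recursion for
  \<open>expand\<close>.\<close>

lemma E_schurQ:
  assumes "strict_partition l" "\<And>b. b \<in> set l \<Longrightarrow> b \<le> m"
  shows "E (int (sum_list l) - d) (schurQ l) = expand m (set l) d (1, 0, 0, 0)"
  using assms
proof (induction "sum_list l" arbitrary: l m d rule: less_induct)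
  case less
  show ?case
  proof (cases l)
    case Nil
    then have "expand m (set l) d (1, 0, 0, 0) = expand 0 {} d (1, 0, 0, 0)"
      by (simp only: Nil list.set) (rule expand_extend, auto)
    then show ?thesis using Nil by (simp add: E_one)
  next
    case l: (Cons a l')
    have l': "strict_partition l'" and a: "a > 0" and lt: "\<And>b. b \<in> set l' \<Longrightarrow> b < a"
      using less.prems(1) by (auto simp: l strict_partition_Cons)
    have IH: "E (int (sum_list k) - d) (schurQ k) = expand m (set k) d (1, 0, 0, 0)"
      if "sum_list k < sum_list l" "strict_partition k" "\<And>b. b \<in> set k \<Longrightarrow> b \<le> m" for k d m
      using less.hyps that by blast
    have *: "int (sum_list (a # l')) = int a + int (sum_list l')" by simp
    have "E (int (sum_list l) - d) (schurQ l) = expand a (set l) d (1, 0, 0, 0)"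
    proof -
      \<comment> \<open>\<open>expand_rec\<close> needs three levels, hence a \<ge> 3. For smaller a
        the operators Q_0 and Q_{-1} enter, with Q_0 1 = 1 and Q_{-1} 1 = 0.\<close>
      consider "a = 1" | "a = 2" | i where "a = Suc (Suc (Suc i))"
        using a by (metis One_nat_def Suc_1 gr0_conv_Suc not0_implies_Suc)
      then show ?thesis
      proof cases
        case 1
        have [simp]: "l' = []"
        proof (cases l')
          case (Cons b l'')
          then show ?thesis using lt [of b] l' 1 by (simp add: strict_partition_Cons)
        qed
        show ?thesis unfolding l unfolding E_schurQ_Cons unfolding *
          by (simp add: 1 Qop_1 E_one const_mult const_diff algebra_simps)
      next
        case 2
        have IH1: "E (1 - d) (Qop 1 1) = expand 1 {1} d (1, 0, 0, 0)" for d
          using IH [of "[1]" 1] by (simp add: l 2 schurQ_Cons strict_partition_Cons)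
        show ?thesis
        proof (cases l')
          case Nil
          show ?thesis unfolding l unfolding E_schurQ_Cons unfolding * using IH1 [of d]
            by (simp add: 2 Nil numeral_2_eq_2 E_one Qop_1 Qop_const Qop_numeral Qop_diff Qop_const_mult const_add const_mult const_diff algebra_simps)
        next
          case (Cons b l'')
          then have "b = 1" using lt [of b] l' 2 by (simp add: strict_partition_Cons)
          moreover have "l'' = []" using l' \<open>b = 1\<close> unfolding Cons
            by (cases l'') (auto simp: strict_partition_Cons)
          ultimately have Cons: "l' = [1]" by (simp add: Cons)
          \<comment> \<open>Lowering the part 2 meets the part 1 or passes it as Q_0, which picks up
            a sign and then acts as 1 on 1.\<close>
          have "Qop 1 (X 1) = 0" using Qop_square [of 1 1] by (simp add: Qop_1)
          moreover have "Qop 0 (X 1) = - X 1" using Qop_swap [of 0 1 1] by (simp add: Qop_1)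
          ultimately show ?thesis unfolding l unfolding E_schurQ_Cons unfolding * using IH1 [of d] IH1 [of "d - 1"] IH1 [of "d - 2"]
            by (simp add: 2 Cons numeral_2_eq_2 E_one Qop_1 Qop_const Qop_numeral Qop_diff Qop_const_mult Qop_add flow_uminus schurQ_Cons const_add const_mult const_diff algebra_simps)
        qed
      next
        case (3 i)
        let ?L = "set l'" and ?b1 = "Suc (Suc i)" and ?b2 = "Suc i"
        have le: "b \<le> ?b1" if "b \<in> ?L" for b using lt [OF that] 3 by simp
        have k: "int (sum_list l) = int a + int (sum_list l')" by (simp add: l)
        have a': "int (Suc ?b1) - 1 = int ?b1" "int (Suc ?b1) - 2 = int ?b2" by simp_all
        \<comment> \<open>The lowered part a - 1 is either still strictly the largest, so the
          induction hypothesis applies, or repeats the head of l'.\<close>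
        have T1: "E (int (sum_list l) - d - 1) (Qop (int ?b1) (schurQ l')) =
            (if ?b1 \<in> ?L then 0 else expand ?b1 (insert ?b1 ?L) d (1, 0, 0, 0))"
        proof (cases "?b1 \<in> ?L")
          case True
          then obtain l'' where "l' = ?b1 # l''" using strict_partition_max l' le by blast
          then show ?thesis by (simp add: schurQ_Cons Qop_square)
        next
          case False
          then have "strict_partition (?b1 # l')"
            using le l' by (auto simp: strict_partition_Cons less_le)
          then have "E (int (sum_list (?b1 # l')) - d) (schurQ (?b1 # l')) = expand ?b1 (set (?b1 # l')) d (1, 0, 0, 0)"
            using le 3 by (intro IH) (auto simp: l)
          moreover have "int (sum_list l) - d - 1 = int (sum_list (?b1 # l')) - d" using 3 by (simp add: l)
          ultimately show ?thesis using False by (simp only: schurQ_Cons) simp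
        qed
        have T2: "E (int (sum_list l) - d - 2) (Qop (int ?b2) (schurQ l')) =
            (if ?b2 \<in> ?L then 0 else (if ?b1 \<in> ?L then - 1 else 1) * expand ?b1 (insert ?b2 ?L) d (1, 0, 0, 0))"
        proof (cases "?b1 \<in> ?L")
          case True
          then obtain l'' where l'': "l' = ?b1 # l''" using strict_partition_max l' le by blast
          then have sp: "strict_partition l''" and le': "\<And>b. b \<in> set l'' \<Longrightarrow> b \<le> ?b2"
            using l' by (auto simp: strict_partition_Cons)
          have swap: "Qop (int ?b2) (schurQ l') = - Qop (int ?b1) (Qop (int ?b2) (schurQ l''))"
            unfolding l'' schurQ_Cons by (rule Qop_swap) simp
          show ?thesis
          proof (cases "?b2 \<in> ?L")
            case True
            then have "?b2 \<in> set l''" by (simp add: l'')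
            then obtain l3 where "l'' = ?b2 # l3" using strict_partition_max sp le' by blast
            then show ?thesis using True unfolding swap by (simp add: schurQ_Cons Qop_square)
          next
            case False
            then have "strict_partition (?b1 # ?b2 # l'')"
              using sp by (auto simp: strict_partition_Cons less_le l'' dest: le')
            then have "E (int (sum_list (?b1 # ?b2 # l'')) - d) (schurQ (?b1 # ?b2 # l''))
                = expand ?b1 (set (?b1 # ?b2 # l'')) d (1, 0, 0, 0)"
              using le' 3 by (intro IH) (auto simp: l l'' le_Suc_eq)
            moreover have "int (sum_list l) - d - 2 = int (sum_list (?b1 # ?b2 # l'')) - d"
              using 3 by (simp add: l l'')
            moreover have "set (?b1 # ?b2 # l'') = insert ?b2 ?L" by (auto simp: l'')
            ultimately have "E (int (sum_list l) - d - 2) (Qop (int ?b1) (Qop (int ?b2) (schurQ l'')))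
                = expand ?b1 (insert ?b2 ?L) d (1, 0, 0, 0)"
              by (simp only: schurQ_Cons)
            then show ?thesis using True False unfolding swap by (simp add: flow_uminus)
          qed
        next
          case b1: False
          then have le': "b \<le> ?b2" if "b \<in> ?L" for b
            using le [OF that] that by (auto simp: le_Suc_eq)
          show ?thesis
          proof (cases "?b2 \<in> ?L")
            case True
            then obtain l'' where "l' = ?b2 # l''" using strict_partition_max l' le' by blast
            then show ?thesis using True by (simp add: schurQ_Cons Qop_square)
          next
            case False
            then have "strict_partition (?b2 # l')"
              using le' l' by (auto simp: strict_partition_Cons less_le)
            then have "E (int (sum_list (?b2 # l')) - d) (schurQ (?b2 # l')) = expand ?b1 (set (?b2 # l')) d (1, 0, 0, 0)"
              using le 3 by (intro IH) (auto simp: l)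
            moreover have "int (sum_list l) - d - 2 = int (sum_list (?b2 # l')) - d" using 3 by (simp add: l)
            ultimately show ?thesis using False b1 by (simp only: schurQ_Cons) simp
          qed
        qed
        have IH': "E (int (sum_list l') - d) (schurQ l') = expand ?b1 ?L d (1, 0, 0, 0)" for d
          using a by (intro IH l' le) (simp add: l)
        have l3: "l = Suc ?b1 # l'" by (simp add: l 3)
        have e: "E (int (sum_list l) - d) (schurQ l) =
            const (q - 1) * (if ?b1 \<in> ?L then 0 else expand ?b1 (insert ?b1 ?L) d (1, 0, 0, 0))
          + const q * (if ?b2 \<in> ?L then 0 else (if ?b1 \<in> ?L then - 1 else 1) * expand ?b1 (insert ?b2 ?L) d (1, 0, 0, 0))
          + Qop (int (Suc ?b1)) (expand ?b1 ?L (d - int (Suc ?b1)) (1, 0, 0, 0))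
          + const (q - 1) * Qop (int ?b1) (expand ?b1 ?L (d - int ?b1) (1, 0, 0, 0))
          - const q * Qop (int ?b2) (expand ?b1 ?L (d - int ?b2) (1, 0, 0, 0))"
          by (rule E_schurQ_Cons [of "Suc ?b1" l' d, folded l3, unfolded a' T1 T2 IH'])
        show ?thesis
          unfolding e using expand_rec [OF le, where d = d] by (simp only: l3 list.set 3)
      qed
    qed
    also have "\<dots> = expand m (set l) d (1, 0, 0, 0)"
      using less.prems(2) by (intro expand_extend [symmetric]) (auto simp: l dest: lt)
    finally show ?thesis .
  qed
qed

section \<open>Expansion as a sum over strict partitions\<close>

definition bounded_strict :: "nat \<Rightarrow> int \<Rightarrow> nat list set" where
  "bounded_strict m d = {nu. strict_partition nu \<and> (\<forall>b\<in>set nu. b \<le> m) \<and> int (sum_list nu) = d}"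

lemma bounded_strict_0: "bounded_strict 0 d = (if d = 0 then {[]} else {})"
proof -
  have "nu = []" if "strict_partition nu" "\<forall>b\<in>set nu. b \<le> 0" for nu
    using that by (cases nu) (auto simp: strict_partition_Cons)
  then show ?thesis by (auto simp: bounded_strict_def)
qed

text \<open>With integer d the second set is simply empty when m + 1 exceeds d.\<close>

lemma bounded_strict_Suc:
  "bounded_strict (Suc m) d = bounded_strict m d \<union> Cons (Suc m) ` bounded_strict m (d - int (Suc m))"
proof (intro equalityI subsetI)
  fix nu assume nu: "nu \<in> bounded_strict (Suc m) d"
  show "nu \<in> bounded_strict m d \<union> Cons (Suc m) ` bounded_strict m (d - int (Suc m))"
  proof (cases nu)
    case Nil
    then show ?thesis using nu by (auto simp: bounded_strict_def)
  next
    case (Cons a l)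
    with nu have *: "strict_partition l" "\<And>b. b \<in> set l \<Longrightarrow> b < a" "a > 0" "a \<le> Suc m" "int a + int (sum_list l) = d"
      by (simp_all add: bounded_strict_def strict_partition_Cons)
    show ?thesis
    proof (cases "a = Suc m")
      case True
      with * have "l \<in> bounded_strict m (d - int (Suc m))"
        by (simp add: bounded_strict_def less_Suc_eq_le)
      with True show ?thesis by (simp add: Cons)
    next
      case False
      with *(4) have "a \<le> m" by simp
      then have "nu \<in> bounded_strict m d"
        using * order.trans [OF less_imp_le [OF *(2)] \<open>a \<le> m\<close>] 
        by (simp add: Cons bounded_strict_def strict_partition_Cons)
      then show ?thesis by simp
    qed
  qed
qed (auto simp: bounded_strict_def strict_partition_Cons less_Suc_eq_le intro: le_SucI)

lemma finite_bounded_strict: "finite (bounded_strict m d)"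
  by (induction m arbitrary: d) (simp_all add: bounded_strict_0 bounded_strict_Suc)

lemma scan_cong:
  assumes "\<And>i. 1 \<le> i \<Longrightarrow> i \<le> m \<Longrightarrow> i \<in> N \<longleftrightarrow> i \<in> N'"
  shows "scan t m L N s = scan t m L N' s"
  using assms by (induction m arbitrary: s) auto

lemma expand_eq_sum:
  "expand m L d s = (\<Sum>nu\<in>bounded_strict m d. const (scan q m L (set nu) s) * schurQ nu)"
proof (induction m arbitrary: d s)
  case 0
  then show ?case by (simp add: bounded_strict_0)
next
  case (Suc m)
  have inj: "inj_on (Cons (Suc m)) A" for A by (simp add: inj_on_def)
  have disj: "bounded_strict m d \<inter> Cons (Suc m) ` bounded_strict m (d - int (Suc m)) = {}"
  proof -
    have "Suc m \<notin> set nu" if "nu \<in> bounded_strict m d" for nu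
      using that Suc_n_not_le_n unfolding bounded_strict_def by blast
    then show ?thesis by force
  qed
  have 1: "const (scan q (Suc m) L (set nu) s) * schurQ nu
      = const (scan q m L (set nu) (step q (Suc m \<in> L) False s)) * schurQ nu"
    if "nu \<in> bounded_strict m d" for nu
  proof -
    have "\<forall>b\<in>set nu. b \<le> m" using that by (simp add: bounded_strict_def)
    then have "Suc m \<notin> set nu" by (meson Suc_n_not_le_n)
    then show ?thesis by simp
  qed
  have 2: "const (scan q (Suc m) L (set (Suc m # nu)) s) * schurQ (Suc m # nu)
      = Qop (int (Suc m)) (const (scan q m L (set nu) (step q (Suc m \<in> L) True s)) * schurQ nu)" for nu
  proof -
    have "scan q m L (insert (Suc m) (set nu)) = scan q m L (set nu)"
      by (intro ext scan_cong) auto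
    then show ?thesis by (simp add: schurQ_Cons Qop_const_mult)
  qed
  have "(\<Sum>nu\<in>bounded_strict (Suc m) d. const (scan q (Suc m) L (set nu) s) * schurQ nu) =
      (\<Sum>nu\<in>bounded_strict m d. const (scan q m L (set nu) (step q (Suc m \<in> L) False s)) * schurQ nu)
    + (\<Sum>nu\<in>bounded_strict m (d - int (Suc m)).
        Qop (int (Suc m)) (const (scan q m L (set nu) (step q (Suc m \<in> L) True s)) * schurQ nu))"
    unfolding bounded_strict_Suc
      sum.union_disjoint [OF finite_bounded_strict finite_imageI [OF finite_bounded_strict] disj]
      sum.reindex [OF inj] comp_def 2
    by (rule arg_cong2 [where f = "(+)", OF sum.cong [OF refl 1] refl])
  then show ?case
    by (simp only: expand.simps Suc Qop_sum)
qed

subsection \<open>The bilinear form\<close>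

lemma pairing_superset:
  assumes "finite S" "Poly_Mapping.keys f \<subseteq> S"
  shows "pairing f g = (\<Sum>m\<in>S. Poly_Mapping.lookup f m * Poly_Mapping.lookup g m * (of_nat (mono_z m) / 2 ^ mono_len m))"
  unfolding pairing_def using assms
  by (intro sum.mono_neutral_left) (auto simp: in_keys_iff)

lemma pairing_add_left: "pairing (f + f') g = pairing f g + pairing f' g"
  by (subst (1 2 3) pairing_superset [where S = "Poly_Mapping.keys f \<union> Poly_Mapping.keys f'"])
    (use keys_add [of f f'] in \<open>auto simp: lookup_add distrib_right add_divide_distrib sum.distrib\<close>)

lemma pairing_add_right: "pairing f (g + g') = pairing f g + pairing f g'"
  by (simp add: pairing_def lookup_add distrib_left distrib_right add_divide_distrib sum.distrib)

lemma pairing_0_left [simp]: "pairing 0 g = 0" and pairing_0_right [simp]: "pairing f 0 = 0"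
  by (simp_all add: pairing_def)

lemma pairing_const_mult_right: "pairing f (const c * g) = c * pairing f g"
  unfolding pairing_def lookup_const_mult sum_distrib_left by (simp add: mult_ac)

lemma pairing_const_mult_left: "pairing (const c * f) g = c * pairing f g"
proof -
  have "Poly_Mapping.keys (const c * f) \<subseteq> Poly_Mapping.keys f"
    by (auto simp: in_keys_iff)
  then show ?thesis
    unfolding pairing_superset [OF finite_keys \<open>Poly_Mapping.keys (const c * f) \<subseteq> _\<close>]
      pairing_def [of f] lookup_const_mult sum_distrib_left by (simp add: mult_ac)
qed

lemma pairing_sum_left: "pairing (sum f A) g = (\<Sum>x\<in>A. pairing (f x) g)"
  by (induction A rule: infinite_finite_induct) (auto simp: pairing_add_left)

lemma pairing_sum_right: "pairing f (sum g A) = (\<Sum>x\<in>A. pairing f (g x))"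
  by (induction A rule: infinite_finite_induct) (auto simp: pairing_add_right)

lemma pairing_single: "pairing (Poly_Mapping.single m c) g =
    c * Poly_Mapping.lookup g m * (of_nat (mono_z m) / 2 ^ mono_len m)"
  by (subst pairing_superset [where S = "{m}"]) auto

lemma mono_len_Suc: "mono_len (Poly_Mapping.single k 1 + m) = Suc (mono_len m)"
proof -
  have superset: "mono_len m = (\<Sum>k\<in>S. Poly_Mapping.lookup m k)" if "finite S" "Poly_Mapping.keys m \<subseteq> S" for m S
    unfolding mono_len_def using that by (intro sum.mono_neutral_left) (auto simp: in_keys_iff)
  let ?S = "insert k (Poly_Mapping.keys m)"
  have "Poly_Mapping.keys (Poly_Mapping.single k 1 + m) \<subseteq> ?S"
    using keys_add [of "Poly_Mapping.single k 1" m] by auto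
  then show ?thesis
    by (subst (1 2) superset [where S = ?S])
      (auto simp: lookup_add sum.distrib lookup_single when_def)
qed

lemma mono_z_Suc: "mono_z (Poly_Mapping.single k 1 + m) = (2 * k + 1) * Suc (Poly_Mapping.lookup m k) * mono_z m"
proof -
  let ?z = "\<lambda>m k. (2 * k + 1) ^ Poly_Mapping.lookup m k * fact (Poly_Mapping.lookup m k) :: nat"
  have superset: "mono_z m = (\<Prod>k\<in>S. ?z m k)" if "finite S" "Poly_Mapping.keys m \<subseteq> S" for m S
    unfolding mono_z_def using that by (intro prod.mono_neutral_left) (auto simp: in_keys_iff)
  let ?S = "insert k (Poly_Mapping.keys m)" and ?m = "Poly_Mapping.single k 1 + m"
  have "Poly_Mapping.keys ?m \<subseteq> ?S"
    using keys_add [of "Poly_Mapping.single k 1" m] by auto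
  then have "mono_z ?m = ?z ?m k * (\<Prod>j\<in>?S - {k}. ?z ?m j)"
    by (subst superset [of ?S]) (simp_all add: prod.remove [of ?S k] del: insert_Diff_single)
  also have "(\<Prod>j\<in>?S - {k}. ?z ?m j) = (\<Prod>j\<in>?S - {k}. ?z m j)"
    by (intro prod.cong refl) (auto simp: lookup_add lookup_single)
  also have "?z ?m k = (2 * k + 1) * Suc (Poly_Mapping.lookup m k) * ?z m k"
    by (simp add: lookup_add algebra_simps)
  finally have "mono_z ?m = (2 * k + 1) * Suc (Poly_Mapping.lookup m k) * (?z m k * (\<Prod>j\<in>?S - {k}. ?z m j))"
    by (simp only: mult.assoc)
  also have "?z m k * (\<Prod>j\<in>?S - {k}. ?z m j) = (\<Prod>j\<in>?S. ?z m j)"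
    by (rule prod.remove [symmetric]) auto
  also have "\<dots> = mono_z m"
    by (rule superset [symmetric]) auto
  finally show ?thesis .
qed

text \<open>The adjoint of p_j is (j/2) d/dp_j: a further factor p_j multiplies z by j (m_j + 1) and
  2^(-l) by 1/2, and m_j + 1 is supplied by the derivative.\<close>

lemma pairing_psum_mult:
  assumes "odd j"
  shows "pairing (psum j * h) f = of_nat j / 2 * pairing h (pdiff j f)"
proof (induction h rule: poly_mapping_single_induct)
  case (single m c)
  have j: "2 * (j div 2) + 1 = j" using assms by simp
  show ?case
    unfolding psum_def mult_single pairing_single mono_z_Suc mono_len_Suc lookup_pdiff j
    unfolding add.commute [of m] Suc_eq_plus1 [symmetric]
    by (simp add: mult_ac distrib_left distrib_right add_divide_distrib)
next
  case (add f g)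
  then show ?case by (simp add: distrib_left pairing_add_left)
qed simp

lemma gfun_eq_wave: "gfun n = wave (\<lambda>j. q ^ j - 1) (int n)"
  by (simp add: gfun_def wave_def)

text \<open>Multiplication by g(u) and E(u) are adjoint, as their recursions correspond: 2 (q^j - 1)
  times j/2 is \<open>gderiv j\<close>.\<close>

lemma pairing_wave_mult: "pairing (wave (\<lambda>j. q ^ j - 1) n * h) f = pairing h (E n f)"
proof (induction n arbitrary: f rule: int_strong_induct)
  case (step n)
  let ?b = "\<lambda>j. q ^ j - 1" and ?N = "nat n"
  show ?case
  proof (cases "n = 0")
    case False
    have "of_int n * pairing (wave ?b n * h) f = pairing (const (of_int n) * wave ?b n * h) f"
      by (simp only: mult.assoc pairing_const_mult_left)
    also have "\<dots> = (\<Sum>j\<in>odds ?N. 2 * ?b j * pairing (psum j * (wave ?b (n - int j) * h)) f)"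
    proof -
      have "n \<le> int ?N" by simp
      note rec = wave_rec [OF this]
      show ?thesis
        unfolding rec sum_distrib_right pairing_sum_left mult.assoc pairing_const_mult_left ..
    qed
    also have "\<dots> = (\<Sum>j\<in>odds ?N. gderiv j * pairing h (pdiff j (E (n - int j) f)))"
    proof (intro sum.cong refl)
      fix j assume "j \<in> odds ?N"
      then have j: "odd j" "n - int j < n" using odd_pos by auto
      show "2 * ?b j * pairing (psum j * (wave ?b (n - int j) * h)) f = gderiv j * pairing h (pdiff j (E (n - int j) f))"
        unfolding pairing_psum_mult [OF j(1)] step(2) [OF j(2)] flow_pdiff by (simp add: gderiv_def)
    qed
    also have "\<dots> = pairing h (const (of_int n) * E n f)"
      unfolding flow_rec_nat pairing_sum_right pairing_const_mult_right ..
    finally show ?thesis using False by (simp add: pairing_const_mult_right)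
  qed simp
qed simp

subsection \<open>The weight of a border strip\<close>

lemma refines_single: "refines [x] tau \<longleftrightarrow> tau = [x]"
proof
  assume "refines [x] tau"
  then obtain bs where bs: "concat bs = [x]" "[] \<notin> set bs" "map sum_list bs = tau"
    by (auto simp: refines_def)
  then obtain b bs' where "bs = b # bs'" by (cases bs) auto
  with bs obtain y b' where "b = y # b'" by (cases b) auto
  with bs \<open>bs = b # bs'\<close> have "b = [x]" "concat bs' = []" "[] \<notin> set bs'" by auto
  then have "b = [x]" "bs' = []" by (simp, cases bs') auto
  then show "tau = [x]" using bs \<open>bs = b # bs'\<close> by simp
qed (auto simp: refines_def intro!: exI [of _ "[[x]]"])

text \<open>The last part y either forms a block alone or shares its block with x.\<close>

lemma refines_snoc_snoc:
  "{tau. refines (rs @ [x, y]) tau} = (\<lambda>tau. tau @ [y]) ` {tau. refines (rs @ [x]) tau} \<union> {tau. refines (rs @ [x + y]) tau}"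
proof (intro equalityI subsetI)
  fix tau assume "tau \<in> {tau. refines (rs @ [x, y]) tau}"
  then obtain bs where bs: "concat bs = rs @ [x, y]" "[] \<notin> set bs" "map sum_list bs = tau"
    by (auto simp: refines_def)
  then obtain bs' b where b: "bs = bs' @ [b]" by (cases bs rule: rev_cases) auto
  with bs obtain b' where b': "b = b' @ [y]" and c: "concat bs' @ b' = rs @ [x]"
    by (cases b rule: rev_cases) auto
  show "tau \<in> (\<lambda>tau. tau @ [y]) ` {tau. refines (rs @ [x]) tau} \<union> {tau. refines (rs @ [x + y]) tau}"
  proof (cases "b' = []")
    case True
    then have "refines (rs @ [x]) (map sum_list bs')" using bs b c by (auto simp: refines_def)
    moreover have "tau = map sum_list bs' @ [y]" using bs b b' True by simp
    ultimately show ?thesis by blast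
  next
    case False
    then obtain b'' where b'': "b' = b'' @ [x]" and "concat bs' @ b'' = rs"
      using c by (cases b' rule: rev_cases) auto
    then have "refines (rs @ [x + y]) tau"
      using bs b b' unfolding refines_def by (intro exI [of _ "bs' @ [b'' @ [x + y]]"]) auto
    then show ?thesis by simp
  qed
next
  fix tau assume "tau \<in> (\<lambda>tau. tau @ [y]) ` {tau. refines (rs @ [x]) tau} \<union> {tau. refines (rs @ [x + y]) tau}"
  then consider tau' where "tau = tau' @ [y]" "refines (rs @ [x]) tau'" | "refines (rs @ [x + y]) tau" by blast
  then show "tau \<in> {tau. refines (rs @ [x, y]) tau}"
  proof cases
    case 1
    then obtain bs where "concat bs = rs @ [x]" "[] \<notin> set bs" "map sum_list bs = tau'"
      by (auto simp: refines_def)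
    then have "refines (rs @ [x, y]) tau"
      unfolding refines_def using 1 by (intro exI [of _ "bs @ [[y]]"]) auto
    then show ?thesis by simp
  next
    case 2
    then obtain bs where bs: "concat bs = rs @ [x + y]" "[] \<notin> set bs" "map sum_list bs = tau"
      by (auto simp: refines_def)
    then obtain bs' b where b: "bs = bs' @ [b]" by (cases bs rule: rev_cases) auto
    with bs obtain b' where b': "b = b' @ [x + y]" "concat bs' @ b' = rs"
      by (cases b rule: rev_cases) auto
    then have "refines (rs @ [x, y]) tau"
      unfolding refines_def using bs b by (intro exI [of _ "bs' @ [b' @ [x, y]]"]) auto
    then show ?thesis by simp
  qed
qed

lemma refines_length: "refines rho tau \<Longrightarrow> length tau \<le> length rho"
proof -
  have "[] \<notin> set bs \<Longrightarrow> length bs \<le> length (concat bs)" for bs :: "nat list list"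
    by (induction bs) (auto simp: Suc_le_eq, metis add_less_le_mono length_greater_0_conv add_0)
  then show "refines rho tau \<Longrightarrow> length tau \<le> length rho" by (auto simp: refines_def)
qed

lemma refines_last: "refines (rs @ [x]) tau \<Longrightarrow> tau \<noteq> [] \<and> x \<le> last tau"
proof -
  assume "refines (rs @ [x]) tau"
  then obtain bs where bs: "concat bs = rs @ [x]" "[] \<notin> set bs" "map sum_list bs = tau"
    by (auto simp: refines_def)
  then obtain bs' b where b: "bs = bs' @ [b]" by (cases bs rule: rev_cases) auto
  with bs obtain b' where "b = b' @ [x]" by (cases b rule: rev_cases) auto
  with bs b show ?thesis by auto
qed

lemma finite_refines: "finite {tau. refines (rs @ [x]) tau}"
proof (induction rs arbitrary: x rule: rev_induct)
  case (snoc y rs)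
  then show ?case using refines_snoc_snoc [of rs y x] by simp
next
  case Nil
  have "refines [x] = (\<lambda>tau. tau = [x])" by (intro ext refines_single)
  then show ?case by simp
qed

lemma strip_wt_single [simp]: "strip_wt t [x] = fwt t x"
  by (simp add: strip_wt_def refines_single fprod_def)

text \<open>A separate last block contributes the factor f_y. In the merged case the refined
  composition is one part shorter, which flips the sign.\<close>

lemma strip_wt_snoc_snoc:
  assumes "x > 0"
  shows "strip_wt t (rs @ [x, y]) = fwt t y * strip_wt t (rs @ [x]) - strip_wt t (rs @ [x + y])"
proof -
  let ?A = "{tau. refines (rs @ [x]) tau}" and ?B = "{tau. refines (rs @ [x + y]) tau}"
  let ?g = "\<lambda>tau. (-1) ^ (length (rs @ [x, y]) - length tau) * fprod t tau"
  \<comment> \<open>The first kind ends in y, the second in a part of size at least x + y >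
    y.\<close>
  have disj: "(\<lambda>tau. tau @ [y]) ` ?A \<inter> ?B = {}"
    using assms by (auto dest: refines_last)
  have "strip_wt t (rs @ [x, y]) = sum ?g ((\<lambda>tau. tau @ [y]) ` ?A) + sum ?g ?B"
    unfolding strip_wt_def refines_snoc_snoc
    by (rule sum.union_disjoint) (use disj finite_refines in auto)
  also have "sum ?g ((\<lambda>tau. tau @ [y]) ` ?A) = fwt t y * strip_wt t (rs @ [x])"
    unfolding strip_wt_def sum_distrib_left
    by (subst sum.reindex) (auto simp: inj_on_def fprod_def intro!: sum.cong)
  also have "sum ?g ?B = - strip_wt t (rs @ [x + y])"
    unfolding strip_wt_def sum_negf [symmetric]
  proof (intro sum.cong refl)
    fix tau assume "tau \<in> ?B"
    then have "length tau \<le> Suc (length rs)" using refines_length by fastforce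
    then show "?g tau = - ((-1) ^ (length (rs @ [x + y]) - length tau) * fprod t tau)"
      by (simp add: Suc_diff_le)
  qed
  finally show ?thesis by simp
qed

text \<open>f_i is a combination of t^i and (-1)^i, the powers of the roots of X^2 = (t-1) X + t,
  but only for i > 0, since f_0 = 1.\<close>

lemma fwt_rec:
  assumes "t + 1 \<noteq> 0"
  shows "fwt t 1 = 2 * (t - 1)" "fwt t 2 = 2 * (t - 1) * (t - 1)"
    "i > 0 \<Longrightarrow> fwt t (i + 2) = (t - 1) * fwt t (i + 1) + t * fwt t i"
proof -
  show "fwt t 1 = 2 * (t - 1)" using assms by (simp add: fwt_def)
  have "t\<^sup>2 - 1 = (t + 1) * (t - 1)" by (simp add: power2_eq_square algebra_simps)
  then show "fwt t 2 = 2 * (t - 1) * (t - 1)" using assms by (simp add: fwt_def)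
  show "fwt t (i + 2) = (t - 1) * fwt t (i + 1) + t * fwt t i" if "i > 0"
    using assms that by (simp add: fwt_def divide_simps) (simp add: algebra_simps)
qed

text \<open>The recursion of f is inherited by the last row length, since by
  \<open>strip_wt_snoc_snoc\<close> that length enters only through f and through a shorter
  composition.\<close>

lemma strip_wt_extend:
  assumes "t + 1 \<noteq> 0" "0 \<notin> set rs" "r > 0"
  shows "strip_wt t (rs @ [r + 2]) = (t - 1) * strip_wt t (rs @ [r + 1]) + t * strip_wt t (rs @ [r])"
  using assms(2,3)
proof (induction rs arbitrary: r rule: rev_induct)
  case Nil
  then show ?case using fwt_rec(3) [OF assms(1), of r] by simp
next
  case (snoc x rs)
  then have "x > 0" by auto
  note rec = strip_wt_snoc_snoc [OF this, of t rs]
  have "strip_wt t (rs @ [x + r + 2]) = (t - 1) * strip_wt t (rs @ [x + r + 1]) + t * strip_wt t (rs @ [x + r])"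
    using snoc by simp
  moreover have "fwt t (r + 2) = (t - 1) * fwt t (r + 1) + t * fwt t r"
    using fwt_rec(3) [OF assms(1)] snoc by blast
  ultimately show ?case
    using rec [of "r + 2"] rec [of "r + 1"] rec [of r] by (simp add: add.assoc) (simp add: algebra_simps)
qed

subsection \<open>Connected components and rows\<close>

abbreviation adj_on :: "(nat \<times> nat) set \<Rightarrow> ((nat \<times> nat) \<times> (nat \<times> nat)) set" where
  "adj_on S \<equiv> {(s, t). s \<in> S \<and> t \<in> S \<and> adjacent s t}"

lemma components_eq: "components S = (\<lambda>s. (adj_on S)\<^sup>* `` {s}) ` S"
  by (auto simp: components_def quotient_def)

lemma adj_on_Un:
  assumes "\<And>a b. a \<in> A \<Longrightarrow> b \<in> B \<Longrightarrow> \<not> adjacent a b" "s \<in> A"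
  shows "(adj_on (A \<union> B))\<^sup>* `` {s} = (adj_on A)\<^sup>* `` {s}"
proof (intro equalityI subsetI)
  fix u assume "u \<in> (adj_on (A \<union> B))\<^sup>* `` {s}"
  then have "(s, u) \<in> (adj_on (A \<union> B))\<^sup>*" by simp
  then have "(s, u) \<in> (adj_on A)\<^sup>* \<and> u \<in> A"
  proof induction
    case (step y z)
    then have "y \<in> A" "z \<in> A \<union> B" "adjacent y z" by simp_all
    then have "z \<in> A" using assms(1) [of y z] by blast
    then show ?case using step \<open>y \<in> A\<close> \<open>adjacent y z\<close> by (auto intro: rtrancl_into_rtrancl)
  qed (use assms in auto)
  then show "u \<in> (adj_on A)\<^sup>* `` {s}" by simp
next
  fix u assume "u \<in> (adj_on A)\<^sup>* `` {s}"
  moreover have "(adj_on A)\<^sup>* \<subseteq> (adj_on (A \<union> B))\<^sup>*" by (rule rtrancl_mono) blast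
  ultimately show "u \<in> (adj_on (A \<union> B))\<^sup>* `` {s}" by blast
qed

lemma adjacent_sym: "adjacent s t \<longleftrightarrow> adjacent t s"
  by (auto simp: adjacent_def abs_minus_commute)

lemma components_Un:
  assumes "\<And>a b. a \<in> A \<Longrightarrow> b \<in> B \<Longrightarrow> \<not> adjacent a b"
  shows "components (A \<union> B) = components A \<union> components B"
proof -
  have nadj: "\<not> adjacent a b" if "a \<in> B" "b \<in> A" for a b
    using assms [OF that(2,1)] by (simp add: adjacent_sym)
  have "(adj_on (A \<union> B))\<^sup>* `` {s} = (adj_on B)\<^sup>* `` {s}" if "s \<in> B" for s
    using adj_on_Un [OF nadj that] by (simp only: Un_commute [of A])
  then show ?thesis
    unfolding components_eq image_Un
    by (intro arg_cong2 [where f = "(\<union>)"] image_cong refl adj_on_Un [OF assms])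
qed

lemma components_subset:
  assumes "C \<in> components S"
  shows "C \<subseteq> S \<and> C \<noteq> {}"
proof -
  obtain s where s: "s \<in> S" "C = (adj_on S)\<^sup>* `` {s}" using assms unfolding components_eq by blast
  have "u \<in> S" if "(s, u) \<in> (adj_on S)\<^sup>*" for u
    using that s(1) by (induction rule: rtrancl_induct) simp_all
  then show ?thesis unfolding s(2) by blast
qed

lemma finite_components: "finite S \<Longrightarrow> finite (components S)"
  by (simp add: components_eq)

lemma components_empty [simp]: "components {} = {}"
  by (simp add: components_eq)

lemma prod_components_Un:
  assumes "\<And>a b. a \<in> A \<Longrightarrow> b \<in> B \<Longrightarrow> \<not> adjacent a b" "finite A" "finite B" "A \<inter> B = {}"
  shows "(\<Prod>C\<in>components (A \<union> B). \<phi> C) = (\<Prod>C\<in>components A. \<phi> C) * (\<Prod>C\<in>components B. \<phi> C)"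
proof -
  have "components A \<inter> components B = {}"
  proof (rule equals0I)
    fix C assume "C \<in> components A \<inter> components B"
    then have "C \<subseteq> A" "C \<subseteq> B" "C \<noteq> {}" using components_subset [of C A] components_subset [of C B] by simp_all
    then show False using assms(4) by blast
  qed
  moreover have "components (A \<union> B) = components A \<union> components B"
    using assms(1) by (rule components_Un)
  ultimately show ?thesis using assms(2,3) by (simp add: prod.union_disjoint finite_components)
qed

lemma components_path:
  assumes "a \<le> b" "\<And>i. a \<le> i \<Longrightarrow> i < b \<Longrightarrow> adjacent (p i) (p (Suc i))"
  shows "components (p ` {a..b}) = {p ` {a..b}}"
proof -
  let ?S = "p ` {a..b}"
  have sym: "sym ((adj_on ?S)\<^sup>*)"
    by (intro sym_rtrancl symI) (auto simp: adjacent_sym)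
  have conn: "(p a, p i) \<in> (adj_on ?S)\<^sup>*" if "a \<le> i" "i \<le> b" for i
    using that
  proof (induction i rule: dec_induct)
    case (step n)
    then have "(p n, p (Suc n)) \<in> adj_on ?S" using assms(2) [of n] by auto
    then show ?case using step by (auto intro: rtrancl_into_rtrancl)
  qed simp
  have "(adj_on ?S)\<^sup>* `` {p i} = ?S" if i: "a \<le> i" "i \<le> b" for i
  proof (intro equalityI)
    have "(adj_on ?S)\<^sup>* `` {p i} \<in> components ?S" using i by (auto simp: components_eq)
    then show "(adj_on ?S)\<^sup>* `` {p i} \<subseteq> ?S" using components_subset by simp
    show "?S \<subseteq> (adj_on ?S)\<^sup>* `` {p i}"
    proof
      fix s assume "s \<in> ?S"
      then obtain j where "s = p j" "a \<le> j" "j \<le> b" by auto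
      moreover have "(p i, p a) \<in> (adj_on ?S)\<^sup>*" using conn [OF i] sym by (meson symD)
      ultimately show "s \<in> (adj_on ?S)\<^sup>* `` {p i}" using conn [of j] by (auto intro: rtrancl_trans)
    qed
  qed
  then have "components ?S = (\<lambda>i. ?S) ` {a..b}"
    unfolding components_eq image_image by (intro image_cong) simp_all
  then show ?thesis using assms(1) by auto
qed

lemma map_row_card_insert:
  assumes "x \<notin> set rs"
  shows "map (\<lambda>i. card {j. (i, j) \<in> insert (x, y) S}) rs = map (\<lambda>i. card {j. (i, j) \<in> S}) rs"
proof (rule map_cong [OF refl])
  fix i assume "i \<in> set rs"
  with assms have "i \<noteq> x" by blast
  then have "{j. (i, j) \<in> insert (x, y) S} = {j. (i, j) \<in> S}" by blast
  then show "card {j. (i, j) \<in> insert (x, y) S} = card {j. (i, j) \<in> S}" by (rule arg_cong)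
qed

text \<open>A strip is built from the upper right to the lower left, so each new square opens a new
  bottom row or, as in \<open>row_lengths_lengthen\<close>, extends the current one.\<close>

lemma row_lengths_new_row:
  assumes "finite S" "\<And>i. i \<in> fst ` S \<Longrightarrow> i < x"
  shows "row_lengths (insert (x, y) S) = row_lengths S @ [1]"
proof -
  let ?is = "sorted_list_of_set (fst ` S)"
  have x: "x \<notin> fst ` S" using assms(2) by blast
  have rows: "sorted_list_of_set (fst ` insert (x, y) S) = ?is @ [x]"
    using assms x by (intro sorted_list_of_set_unique [THEN iffD1]) (simp_all add: sorted_wrt_append)
  have "{j. (x, j) \<in> insert (x, y) S} = {y}" using x by (auto simp: image_iff)
  then have "card {j. (x, j) \<in> insert (x, y) S} = 1" by simp
  moreover have "x \<notin> set ?is" using assms(1) x by simp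
  ultimately show ?thesis
    unfolding row_lengths_def rows map_append by (simp only: map_row_card_insert not_False_eq_True list.map)
qed

definition lengthen :: "nat list \<Rightarrow> nat list" where
  "lengthen l = butlast l @ [Suc (last l)]"

lemma row_lengths_lengthen:
  assumes "finite S" "(x, y) \<notin> S" "x \<in> fst ` S" "\<And>i. i \<in> fst ` S \<Longrightarrow> i \<le> x"
  shows "row_lengths (insert (x, y) S) = lengthen (row_lengths S)"
proof -
  let ?is = "sorted_list_of_set (fst ` S - {x})"
  have ins: "fst ` insert (x, y) S = fst ` S" using assms(3) by auto
  have rows: "sorted_list_of_set (fst ` S) = ?is @ [x]"
    using assms card_Suc_Diff1 [OF finite_imageI [OF assms(1)] assms(3)]
    by (intro sorted_list_of_set_unique [THEN iffD1])
      (simp_all add: sorted_wrt_append le_neq_implies_less insert_absorb)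
  have card: "card {j. (x, j) \<in> insert (x, y) S} = Suc (card {j. (x, j) \<in> S})"
  proof -
    have "{j. (x, j) \<in> insert (x, y) S} = insert y {j. (x, j) \<in> S}" by auto
    moreover have "finite {j. (x, j) \<in> S}"
      by (rule finite_subset [of _ "snd ` S"]) (use assms(1) in force)+
    ultimately show ?thesis using assms(2) by simp
  qed
  have "x \<notin> set ?is" using assms(1) by simp
  then show ?thesis
    unfolding row_lengths_def ins rows map_append lengthen_def
    by (simp only: map_row_card_insert not_False_eq_True list.map butlast_snoc last_snoc card)
qed

subsection \<open>Counting the squares on a diagonal\<close>

text \<open>For strict \<lambda> and m \<ge> 1 this is the number of squares of the shifted diagram
  on the diagonal j - i = m - 1.\<close>

definition parts_ge :: "nat list \<Rightarrow> nat \<Rightarrow> nat" where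
  "parts_ge lam m = length (filter (\<lambda>p. m \<le> p) lam)"

lemma parts_ge_eq_0: "(\<And>b. b \<in> set lam \<Longrightarrow> b < m) \<Longrightarrow> parts_ge lam m = 0"
  by (auto simp: parts_ge_def filter_empty_conv not_le)

lemma less_parts_ge_iff:
  assumes "strict_partition lam"
  shows "i < parts_ge lam m \<longleftrightarrow> i < length lam \<and> m \<le> lam ! i"
  using assms
proof (induction lam arbitrary: i)
  case Nil
  then show ?case by (simp add: parts_ge_def)
next
  case (Cons a l)
  have IH: "i < parts_ge l m \<longleftrightarrow> i < length l \<and> m \<le> l ! i" for i
    using Cons by (simp add: strict_partition_Cons)
  have lt: "b < a" if "b \<in> set l" for b
    using Cons.prems that by (simp add: strict_partition_Cons)
  show ?case
  proof (cases "m \<le> a")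
    case True
    then have "parts_ge (a # l) m = Suc (parts_ge l m)" by (simp add: parts_ge_def)
    then show ?thesis using True IH by (cases i) simp_all
  next
    case False
    then have small: "b < m" if "b \<in> set (a # l)" for b using lt [of b] that by auto
    have "parts_ge (a # l) m = 0" by (rule parts_ge_eq_0) (rule small)
    moreover have "(a # l) ! i < m" if "i < length (a # l)"
      using that by (intro small nth_mem)
    ultimately show ?thesis by (auto simp: not_le simp del: length_Cons)
  qed
qed

lemma parts_ge_Suc:
  assumes "strict_partition lam"
  shows "parts_ge lam m = parts_ge lam (Suc m) + (if m \<in> set lam then 1 else 0)"
  using assms
proof (induction lam)
  case (Cons a l)
  then have "a \<notin> set l" "parts_ge l m = parts_ge l (Suc m) + (if m \<in> set l then 1 else 0)"
    by (auto simp: strict_partition_Cons)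
  then show ?case by (cases "m = a") (auto simp: parts_ge_def Suc_le_eq)
qed (simp add: parts_ge_def)

lemma parts_ge_1:
  assumes "strict_partition lam"
  shows "parts_ge lam (Suc 0) = length lam"
  using assms by (induction lam) (auto simp: parts_ge_def strict_partition_Cons)

lemma mem_shifted_diagram:
  assumes "strict_partition lam"
  shows "(i, j) \<in> shifted_diagram lam \<longleftrightarrow> 1 \<le> i \<and> i \<le> j \<and> i \<le> parts_ge lam (Suc (j - i))"
proof (cases i)
  case (Suc k)
  have "j \<le> i + lam ! k - 1 \<longleftrightarrow> Suc (j - i) \<le> lam ! k" if "i \<le> j"
    using that Suc by auto
  then show ?thesis
    using less_parts_ge_iff [OF assms, of k "Suc (j - i)"] Suc by (auto simp: shifted_diagram_def Suc_le_eq)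
qed (simp add: shifted_diagram_def)

lemma mem_skew:
  assumes "strict_partition lam" "strict_partition nu"
  shows "(i, j) \<in> skew lam nu \<longleftrightarrow>
    1 \<le> i \<and> i \<le> j \<and> parts_ge nu (Suc (j - i)) < i \<and> i \<le> parts_ge lam (Suc (j - i))"
  using assms by (auto simp: skew_def mem_shifted_diagram)

lemma contained_iff:
  assumes "strict_partition lam" "strict_partition nu"
  shows "contained nu lam \<longleftrightarrow> (\<forall>m\<ge>1. parts_ge nu m \<le> parts_ge lam m)"
proof
  assume c: "contained nu lam"
  show "\<forall>m\<ge>1. parts_ge nu m \<le> parts_ge lam m"
  proof (intro allI impI, rule ccontr)
    fix m assume "\<not> parts_ge nu m \<le> parts_ge lam m"
    then have "parts_ge lam m < parts_ge nu m" by simp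
    then have "parts_ge lam m < length nu" "m \<le> nu ! parts_ge lam m"
      using less_parts_ge_iff [OF assms(2)] by blast+
    then have "parts_ge lam m < length lam" "m \<le> lam ! parts_ge lam m"
      using c by (auto simp: contained_def intro: order.trans)
    then show False using less_parts_ge_iff [OF assms(1), of "parts_ge lam m" m] by simp
  qed
next
  assume le: "\<forall>m\<ge>1. parts_ge nu m \<le> parts_ge lam m"
  have "nu ! i \<le> lam ! i" if "i < length nu" for i
  proof -
    have "nu ! i \<noteq> 0" using assms(2) that by (metis nth_mem strict_partition_def)
    have "i < parts_ge nu (nu ! i)" using less_parts_ge_iff [OF assms(2)] that by simp
    also have "\<dots> \<le> parts_ge lam (nu ! i)" using le \<open>nu ! i \<noteq> 0\<close> by simp
    finally show ?thesis using less_parts_ge_iff [OF assms(1)] by simp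
  qed
  moreover have "length nu \<le> length lam"
    using le [rule_format, of 1] assms by (simp add: parts_ge_1)
  ultimately show "contained nu lam" by (simp add: contained_def)
qed

lemma parts_ge_step:
  assumes "strict_partition lam"
  shows "parts_ge lam (Suc m) \<le> parts_ge lam m" "parts_ge lam m \<le> Suc (parts_ge lam (Suc m))"
  using parts_ge_Suc [OF assms, of m] by auto

text \<open>Both conditions on a strip say that no diagonal has two squares: on the main diagonal
  directly, elsewhere because two such squares lie in a 2 x 2 block.\<close>

lemma generalized_strip_iff:
  assumes "strict_partition lam" "strict_partition nu"
  shows "generalized_strip (skew lam nu) \<longleftrightarrow> (\<forall>m\<ge>1. parts_ge lam m \<le> Suc (parts_ge nu m))"
proof
  assume strip: "generalized_strip (skew lam nu)"
  show "\<forall>m\<ge>1. parts_ge lam m \<le> Suc (parts_ge nu m)"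
  proof (intro allI impI, rule ccontr)
    fix m :: nat assume m: "1 \<le> m" and "\<not> parts_ge lam m \<le> Suc (parts_ge nu m)"
    then have two: "Suc (Suc (parts_ge nu m)) \<le> parts_ge lam m" by simp
    let ?i = "Suc (parts_ge nu m)"
    show False
    proof (cases "m = 1")
      case True
      then have "(?i, ?i) \<in> skew lam nu" "(Suc ?i, Suc ?i) \<in> skew lam nu"
        using two by (simp_all add: mem_skew assms)
      then show False using strip unfolding generalized_strip_def by (metis n_not_Suc_n)
    next
      case False
      with m obtain k where k: "m = Suc (Suc k)" by (metis One_nat_def Suc_le_D not0_implies_Suc)
      let ?j = "?i + Suc k"
      \<comment> \<open>The block starts at the top square on the diagonal. Its off-diagonal corners
        are present since the counts change by at most 1 between neighbouring diagonals.\<close>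
      have "{(?i, ?j), (?i, ?j + 1), (?i + 1, ?j), (?i + 1, ?j + 1)} \<subseteq> skew lam nu"
        using two k parts_ge_step [OF assms(1), of m] parts_ge_step [OF assms(2), of m]
          parts_ge_step [OF assms(1), of "Suc k"] parts_ge_step [OF assms(2), of "Suc k"]
        by (simp add: mem_skew assms)
      then show False using strip unfolding generalized_strip_def by blast
    qed
  qed
next
  assume one: "\<forall>m\<ge>1. parts_ge lam m \<le> Suc (parts_ge nu m)"
  have "i = k" if "(i, i + d) \<in> skew lam nu" "(k, k + d) \<in> skew lam nu" for i k d
    using that one [rule_format, of "Suc d"] by (simp add: mem_skew assms)
  note unique = this
  have "\<not> {(i, j), (i, j + 1), (i + 1, j), (i + 1, j + 1)} \<subseteq> skew lam nu" for i j
  proof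
    assume "{(i, j), (i, j + 1), (i + 1, j), (i + 1, j + 1)} \<subseteq> skew lam nu"
    then have "(i, j) \<in> skew lam nu" "(i + 1, j + 1) \<in> skew lam nu" by simp_all
    moreover from this have "i \<le> j" by (simp add: mem_skew assms)
    ultimately show False using unique [of i "j - i" "i + 1"] by simp
  qed
  moreover have "i = k" if "(i, i) \<in> skew lam nu" "(k, k) \<in> skew lam nu" for i k
    using unique [of i 0 k] that by simp
  ultimately show "generalized_strip (skew lam nu)" unfolding generalized_strip_def by blast
qed

text \<open>The parts are the places where g drops.\<close>

lemma ex_strict_partition:
  assumes "\<And>m. g (Suc m) \<le> g m" "\<And>m. g m \<le> Suc (g (Suc m))" "\<And>m. m > M \<Longrightarrow> g m = 0"
  obtains rho where "strict_partition rho" "\<And>m. m \<ge> 1 \<Longrightarrow> parts_ge rho m = g m"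
proof
  let ?R = "{m \<in> {1..M}. g m \<noteq> g (Suc m)}"
  let ?rho = "rev (sorted_list_of_set ?R)"
  show strict: "strict_partition ?rho"
    by (simp add: strict_partition_def sorted_wrt_rev strict_sorted_list_of_set)
  have set: "set ?rho = ?R" by simp
  show "parts_ge ?rho m = g m" if "m \<ge> 1" for m
  proof (cases "m > M")
    case True
    then show ?thesis using assms(3) by (intro trans [OF parts_ge_eq_0]) auto
  next
    case False
    then have "m \<le> Suc M" by simp
    then show ?thesis using that
    proof (induction rule: inc_induct)
      case base
      have "parts_ge ?rho (Suc M) = 0" by (rule parts_ge_eq_0) auto
      then show ?case using assms(3) by simp
    next
      case (step n)
      have "parts_ge ?rho n = g (Suc n) + (if n \<in> ?R then 1 else 0)"
        using parts_ge_Suc [OF strict, of n] step unfolding set by simp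
      then show ?case using assms(1) [of n] assms(2) [of n] step by auto
    qed
  qed
qed

lemma double_strip_iff:
  assumes "strict_partition lam" "strict_partition nu"
  shows "double_strip lam nu \<longleftrightarrow>
    (\<forall>m\<ge>1. parts_ge nu m \<le> parts_ge lam m \<and> parts_ge lam m \<le> parts_ge nu m + 2)"
proof
  assume "double_strip lam nu"
  then obtain rho where rho: "strict_partition rho" "contained nu rho" "contained rho lam"
    "generalized_strip (skew lam rho)" "generalized_strip (skew rho nu)"
    by (auto simp: double_strip_def)
  show "\<forall>m\<ge>1. parts_ge nu m \<le> parts_ge lam m \<and> parts_ge lam m \<le> parts_ge nu m + 2"
  proof (intro allI impI)
    fix m :: nat assume "m \<ge> 1"
    then have "parts_ge nu m \<le> parts_ge rho m" "parts_ge rho m \<le> parts_ge lam m"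
      "parts_ge lam m \<le> Suc (parts_ge rho m)" "parts_ge rho m \<le> Suc (parts_ge nu m)"
      using rho assms by (simp_all add: contained_iff generalized_strip_iff)
    then show "parts_ge nu m \<le> parts_ge lam m \<and> parts_ge lam m \<le> parts_ge nu m + 2" by simp
  qed
next
  assume two: "\<forall>m\<ge>1. parts_ge nu m \<le> parts_ge lam m \<and> parts_ge lam m \<le> parts_ge nu m + 2"
  \<comment> \<open>The smallest intermediate partition: it contains \<nu> and leaves at most one
    square of \<lambda> on each diagonal.\<close>
  define g where "g m = max (parts_ge nu m) (parts_ge lam m - 1)" for m
  define M where "M = Max (insert 0 (set lam \<union> set nu))"
  have M: "b \<le> M" if "b \<in> set lam \<union> set nu" for b
    unfolding M_def using that by (intro Max_ge) auto
  have "g m = 0" if "m > M" for m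
  proof -
    have "b < m" if "b \<in> set lam \<union> set nu" for b
      using M [OF that] \<open>m > M\<close> by simp
    then have "parts_ge lam m = 0" "parts_ge nu m = 0" by (simp_all add: parts_ge_eq_0)
    then show ?thesis by (simp add: g_def)
  qed
  moreover have "g (Suc m) \<le> g m" "g m \<le> Suc (g (Suc m))" for m
    using parts_ge_step [OF assms(1), of m] parts_ge_step [OF assms(2), of m] by (auto simp: g_def)
  ultimately obtain rho where rho: "strict_partition rho" "\<And>m. m \<ge> 1 \<Longrightarrow> parts_ge rho m = g m"
    using ex_strict_partition [of g M] by metis
  have "parts_ge nu m \<le> parts_ge rho m \<and> parts_ge rho m \<le> parts_ge lam m \<and>
      parts_ge lam m \<le> Suc (parts_ge rho m) \<and> parts_ge rho m \<le> Suc (parts_ge nu m)" if "m \<ge> 1" for m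
    using two [rule_format, OF that] rho(2) [OF that] by (auto simp: g_def)
  then show "double_strip lam nu"
    unfolding double_strip_def using rho(1) assms
    by (intro exI [of _ rho]) (simp add: contained_iff generalized_strip_iff)
qed

lemma row_lengths_pos:
  assumes "finite S"
  shows "0 \<notin> set (row_lengths S)" "S \<noteq> {} \<Longrightarrow> row_lengths S \<noteq> []"
proof -
  have pos: "card {j. (i, j) \<in> S} \<noteq> 0" if "i \<in> fst ` S" for i
  proof -
    have "finite {j. (i, j) \<in> S}"
      by (rule finite_subset [of _ "snd ` S"]) (use assms in force)+
    moreover have "{j. (i, j) \<in> S} \<noteq> {}" using that by auto
    ultimately show ?thesis by simp
  qed
  have eq: "set (row_lengths S) = (\<lambda>i. card {j. (i, j) \<in> S}) ` (fst ` S)"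
    using assms by (simp add: row_lengths_def)
  show "0 \<notin> set (row_lengths S)"
  proof
    assume "0 \<in> set (row_lengths S)"
    then obtain i where "0 = card {j. (i, j) \<in> S}" "i \<in> fst ` S" unfolding eq by (rule imageE)
    then show False using pos [of i] by simp
  qed
  show "S \<noteq> {} \<Longrightarrow> row_lengths S \<noteq> []" using assms by (simp add: row_lengths_def)
qed

lemma parts_ge_antimono:
  assumes "strict_partition lam" "i \<le> j"
  shows "parts_ge lam j \<le> parts_ge lam i"
  using assms(2) by (induction rule: dec_induct) (auto intro: order.trans [OF parts_ge_step(1) [OF assms(1)]])

text \<open>These are the entries of \<open>step\<close> for h = 1 staying 1: lengthening the bottom
  row, or opening a new one.\<close>

lemma strip_wt_lengthen:
  assumes "t + 1 \<noteq> 0" "rs \<noteq> []" "0 \<notin> set rs"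
  shows "strip_wt t (lengthen (lengthen rs)) = (t - 1) * strip_wt t (lengthen rs) + t * strip_wt t rs"
    and "strip_wt t (rs @ [1]) = 2 * (t - 1) * strip_wt t rs - strip_wt t (lengthen rs)"
    and "strip_wt t (lengthen (rs @ [1])) =
      (2 * (t - 1) * (t - 1) - t) * strip_wt t rs - (t - 1) * strip_wt t (lengthen rs)"
proof -
  obtain rs' r where rs: "rs = rs' @ [r]" using assms(2) by (cases rs rule: rev_cases) auto
  then have r: "r > 0" "0 \<notin> set rs'" using assms(3) by auto
  have l: "lengthen rs = rs' @ [r + 1]" "lengthen (lengthen rs) = rs' @ [r + 2]"
    "lengthen (rs @ [1]) = rs @ [2]"
    by (simp_all add: lengthen_def rs butlast_append)
  show 1: "strip_wt t (lengthen (lengthen rs)) = (t - 1) * strip_wt t (lengthen rs) + t * strip_wt t rs"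
    using strip_wt_extend [OF assms(1) r(2,1)] unfolding l(2) unfolding l(1) unfolding rs .
  have rec: "strip_wt t (rs @ [x]) = fwt t x * strip_wt t rs - strip_wt t (rs' @ [r + x])" for x
    using strip_wt_snoc_snoc [OF r(1), of t rs' x] by (simp add: rs)
  show "strip_wt t (rs @ [1]) = 2 * (t - 1) * strip_wt t rs - strip_wt t (lengthen rs)"
    unfolding rec l(1) fwt_rec(1) [OF assms(1)] ..
  show "strip_wt t (lengthen (rs @ [1])) =
      (2 * (t - 1) * (t - 1) - t) * strip_wt t rs - (t - 1) * strip_wt t (lengthen rs)"
    unfolding l(3) rec fwt_rec(2) [OF assms(1)] using 1 unfolding l(2) by (simp add: algebra_simps)
qed

section \<open>The scan computes the weight of a pair of strict partitions\<close>

locale strict_pair =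
  fixes lam nu :: "nat list"
  assumes lam: "strict_partition lam" and nu: "strict_partition nu"
begin

definition h :: "nat \<Rightarrow> int" where
  "h m = int (parts_ge lam m) - int (parts_ge nu m)"

text \<open>The lowest square of \<open>\<lambda>\<close> on the diagonal \<open>j - i = m - 1\<close>; it is the only square of \<open>\<lambda>/\<nu>\<close> there
  if \<open>h m = 1\<close>.\<close>

definition sq :: "nat \<Rightarrow> nat \<times> nat" where
  "sq m = (parts_ge lam m, parts_ge lam m + m - 1)"

definition rowl :: "nat \<Rightarrow> nat \<Rightarrow> nat list" where
  "rowl a b = row_lengths (sq ` {a..b})"

lemma h_Suc: "h m = h (Suc m) + (if m \<in> set lam then 1 else 0) - (if m \<in> set nu then 1 else 0)"
  using parts_ge_Suc [OF lam, of m] parts_ge_Suc [OF nu, of m] by (auto simp: h_def)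

lemma h_eventually_0: "\<exists>M. \<forall>m>M. h m = 0"
proof -
  define M where "M = Max (insert 0 (set lam \<union> set nu))"
  have "h m = 0" if "m > M" for m
  proof -
    have "b < m" if "b \<in> set lam \<union> set nu" for b
    proof -
      have "b \<le> M" unfolding M_def using that by (intro Max_ge) auto
      then show ?thesis using \<open>m > M\<close> by simp
    qed
    then have "parts_ge lam m = 0" "parts_ge nu m = 0" by (simp_all add: parts_ge_eq_0)
    then show ?thesis by (simp add: h_def)
  qed
  then show ?thesis by blast
qed

lemma finite_h: "c \<noteq> 0 \<Longrightarrow> finite {j. m < j \<and> h j = c}"
proof -
  assume c: "c \<noteq> 0"
  obtain M where "\<forall>m>M. h m = 0" using h_eventually_0 by blast
  then have "{j. m < j \<and> h j = c} \<subseteq> {..M}" using c by (auto simp: not_less [symmetric])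
  then show "finite {j. m < j \<and> h j = c}" by (rule finite_subset) simp
qed

lemma parts_ge_pos: "h i = 1 \<Longrightarrow> parts_ge lam i > 0"
  by (simp add: h_def)

text \<open>From diagonal index i + 1 to i the lowest square moves one step left if i is not a part
  of \<lambda>, one step down if it is.\<close>

lemma adjacent_sq:
  assumes "1 \<le> i" "h (Suc i) = 1"
  shows "adjacent (sq i) (sq (Suc i))"
  using parts_ge_step [OF lam, of i] parts_ge_pos [OF assms(2)] assms(1)
  by (cases "parts_ge lam i = parts_ge lam (Suc i)") (auto simp: adjacent_def sq_def)

text \<open>Adjacent squares lie on neighbouring diagonals.\<close>

lemma not_adjacent_sq:
  assumes "1 \<le> i" "Suc i < j" "h i = 1" "h j = 1"
  shows "\<not> adjacent (sq i) (sq j)"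
proof -
  have "int (parts_ge lam i + i - 1) = int (parts_ge lam i) + int i - 1"
    "int (parts_ge lam j + j - 1) = int (parts_ge lam j) + int j - 1"
    using assms by simp_all
  moreover have "int i + 2 \<le> int j" using assms by simp
  ultimately show ?thesis unfolding adjacent_def sq_def fst_conv snd_conv by (simp only:)
qed

lemma rowl_single [simp]: "rowl b b = [1]"
  using row_lengths_new_row [of "{}" "fst (sq b)" "snd (sq b)"] by (simp add: rowl_def row_lengths_def)

lemma rowl_shape:
  assumes "a \<le> b"
  shows "rowl a b \<noteq> []" "0 \<notin> set (rowl a b)"
  using assms row_lengths_pos [of "sq ` {a..b}"] by (simp_all add: rowl_def)

lemma rowl_step:
  assumes "1 \<le> a" "a < b" "h a = 1"
  shows "rowl a b = (if a \<in> set lam then rowl (Suc a) b @ [1] else lengthen (rowl (Suc a) b))"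
proof -
  let ?S = "sq ` {Suc a..b}"
  have ins: "sq ` {a..b} = insert (parts_ge lam a, parts_ge lam a + a - 1) ?S"
    using assms by (simp add: atLeastAtMost_insertL [symmetric] sq_def)
  have le: "i \<le> parts_ge lam (Suc a)" if "i \<in> fst ` ?S" for i
    using that parts_ge_antimono [OF lam] by (auto simp: sq_def)
  show ?thesis
  proof (cases "a \<in> set lam")
    case True
    then have "parts_ge lam a = Suc (parts_ge lam (Suc a))" using parts_ge_Suc [OF lam, of a] by simp
    then have "i < parts_ge lam a" if "i \<in> fst ` ?S" for i using le [OF that] by simp
    then show ?thesis using True unfolding rowl_def ins by (simp add: row_lengths_new_row)
  next
    case False
    then have eq: "parts_ge lam a = parts_ge lam (Suc a)" using parts_ge_Suc [OF lam, of a] by simp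
    have "(parts_ge lam a, parts_ge lam a + a - 1) \<notin> ?S"
      using parts_ge_pos [OF assms(3)] by (auto simp: sq_def)
    moreover have "parts_ge lam a \<in> fst ` ?S"
    proof -
      have "sq (Suc a) \<in> ?S" using assms by simp
      then have "fst (sq (Suc a)) \<in> fst ` ?S" by (rule imageI)
      then show ?thesis by (simp add: sq_def eq)
    qed
    moreover have "i \<le> parts_ge lam a" if "i \<in> fst ` ?S" for i using le [OF that] eq by simp
    ultimately show ?thesis using False unfolding rowl_def ins by (simp add: row_lengths_lengthen)
  qed
qed

text \<open>Two cut-offs: double diagonals are counted as soon as they are read, beyond m, while
  strips count only beyond b, because the current one may be unfinished.\<close>

definition partial_wt :: "'a::field \<Rightarrow> nat \<Rightarrow> nat \<Rightarrow> 'a" where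
  "partial_wt t b m = (- t) ^ card {j. m < j \<and> h j = 2}
     * (\<Prod>C\<in>components (sq ` {j. b < j \<and> h j = 1}). strip_wt t (row_lengths C))"

lemma partial_wt_Suc_left: "h (Suc b) \<noteq> 1 \<Longrightarrow> partial_wt t b m = partial_wt t (Suc b) m"
proof -
  assume "h (Suc b) \<noteq> 1"
  then have "{j. b < j \<and> h j = 1} = {j. Suc b < j \<and> h j = 1}"
    by (auto intro!: Suc_lessI)
  then show ?thesis by (simp add: partial_wt_def)
qed

lemma partial_wt_Suc_right: "partial_wt t b m = (if h (Suc m) = 2 then - t else 1) * partial_wt t b (Suc m)"
proof -
  have eq: "{j. m < j \<and> h j = 2} = (if h (Suc m) = 2 then insert (Suc m) {j. Suc m < j \<and> h j = 2}
      else {j. Suc m < j \<and> h j = 2})"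
    by (auto intro!: Suc_lessI)
  show ?thesis unfolding partial_wt_def eq using finite_h [of 2 "Suc m"] by simp
qed

text \<open>The gap at b + 1 separates the run from all earlier squares with h = 1, so the run is a
  single component of its own.\<close>

lemma partial_wt_run:
  assumes "Suc m \<le> b" "\<And>j. Suc m \<le> j \<Longrightarrow> j \<le> b \<Longrightarrow> h j = 1" "h (Suc b) \<noteq> 1"
  shows "partial_wt t m k = partial_wt t (Suc b) k * strip_wt t (rowl (Suc m) b)"
proof -
  let ?A = "{Suc m..b}" and ?B = "{j. Suc b < j \<and> h j = 1}"
  have AB: "{j. m < j \<and> h j = 1} = ?A \<union> ?B"
  proof (intro equalityI subsetI)
    fix j assume "j \<in> {j. m < j \<and> h j = 1}"
    then show "j \<in> ?A \<union> ?B" using assms(3) by (cases "j \<le> b"; cases "j = Suc b") auto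
  qed (use assms in auto)
  have far: "\<not> adjacent (sq i) (sq j)" if "i \<in> ?A" "j \<in> ?B" for i j
    using that assms(2) [of i] by (intro not_adjacent_sq) auto
  have disj: "sq i \<noteq> sq j" if "i \<in> ?A" "j \<in> ?B" for i j
    using that parts_ge_pos [OF assms(2) [of i]] by (auto simp: sq_def)
  have "(\<Prod>C\<in>components (sq ` ?A \<union> sq ` ?B). strip_wt t (row_lengths C)) =
      (\<Prod>C\<in>components (sq ` ?A). strip_wt t (row_lengths C)) * (\<Prod>C\<in>components (sq ` ?B). strip_wt t (row_lengths C))"
  proof (rule prod_components_Un)
    show "\<not> adjacent a b" if "a \<in> sq ` ?A" "b \<in> sq ` ?B" for a b using that far by blast
    show "sq ` ?A \<inter> sq ` ?B = {}" using disj by blast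
  qed (use finite_h in auto)
  moreover have "components (sq ` ?A) = {sq ` ?A}"
    using assms by (intro components_path adjacent_sq) auto
  ultimately show ?thesis
    by (simp add: partial_wt_def AB image_Un rowl_def mult_ac)
qed

definition thin :: "nat \<Rightarrow> bool" where
  "thin m \<longleftrightarrow> (\<forall>j>m. h j \<in> {0, 1, 2})"

text \<open>In the case \<open>h (Suc m) = 1\<close> the interval \<open>{Suc m..b}\<close> is the run of \<open>h = 1\<close> being read.\<close>

definition scan_inv :: "'a::field \<Rightarrow> nat \<Rightarrow> 'a state \<Rightarrow> bool" where
  "scan_inv t m s \<longleftrightarrow> (if thin m then
      h (Suc m) = 0 \<and> s = (partial_wt t m m, 0, 0, 0) \<or>
      h (Suc m) = 2 \<and> s = (0, 0, 0, partial_wt t m m) \<or>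
      h (Suc m) = 1 \<and> (\<exists>b\<ge>Suc m. (\<forall>j\<in>{Suc m..b}. h j = 1) \<and> h (Suc b) \<noteq> 1 \<and>
        s = (0, partial_wt t (Suc b) m * strip_wt t (rowl (Suc m) b),
          partial_wt t (Suc b) m * strip_wt t (lengthen (rowl (Suc m) b)), 0))
    else s = (0, 0, 0, 0))"

lemma scan_inv_runI:
  assumes "thin m" "h (Suc m) = 1" "Suc m \<le> b" "\<forall>j\<in>{Suc m..b}. h j = 1" "h (Suc b) \<noteq> 1"
  shows "scan_inv t m (0, partial_wt t (Suc b) m * strip_wt t (rowl (Suc m) b),
    partial_wt t (Suc b) m * strip_wt t (lengthen (rowl (Suc m) b)), 0)"
  unfolding scan_inv_def if_P [OF assms(1)] using assms by blast

text \<open>h moves by at most 1. Entering h = 1 opens a run, staying extends it by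
  \<open>rowl_step\<close>, leaving it turns its weight into a finished factor, and leaving {0, 1,
  2} kills the state.\<close>

lemma scan_inv_step:
  assumes t: "t + 1 \<noteq> 0" and inv: "scan_inv t (Suc m) s"
  shows "scan_inv t m (step t (Suc m \<in> set lam) (Suc m \<in> set nu) s)" (is "scan_inv t m (step t ?l ?n s)")
proof (cases "thin (Suc m)")
  case False
  then have "s = (0, 0, 0, 0)" using inv unfolding scan_inv_def by (simp only: if_False)
  moreover have "\<not> thin m" using False unfolding thin_def by (meson Suc_lessD)
  ultimately show ?thesis by (cases ?l; cases ?n) (simp_all add: scan_inv_def)
next
  case good: True
  let ?k = "Suc m"
  have hk: "h ?k = h (Suc ?k) + (if ?l then 1 else 0) - (if ?n then 1 else 0)" by (rule h_Suc)
  have good_iff: "thin m \<longleftrightarrow> h ?k \<in> {0, 1, 2}"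
    using good unfolding thin_def by (metis Suc_lessI lessI)
  have left: "partial_wt t m m = partial_wt t ?k m" if "h ?k \<noteq> 1"
    using that by (rule partial_wt_Suc_left)
  have right: "partial_wt t b m = (if h ?k = 2 then - t else 1) * partial_wt t b ?k" for b
    by (rule partial_wt_Suc_right)
  note inv = inv [unfolded scan_inv_def if_P [OF good]]
  \<comment> \<open>A run opens with the single row (1); the two entries are f_1 and the look-ahead
    f_2.\<close>
  have start: "scan_inv t m (0, 2 * (t - 1) * partial_wt t ?k ?k, 2 * (t - 1) * (t - 1) * partial_wt t ?k ?k, 0)"
    if "h ?k = 1" "h (Suc ?k) \<noteq> 1"
  proof -
    have "partial_wt t (Suc ?k) m = partial_wt t ?k ?k"
      using partial_wt_Suc_left [OF that(2), of t ?k] right [of "Suc ?k"] that(1) by simp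
    moreover have "lengthen [1] = [2]" by (simp add: lengthen_def)
    moreover have "scan_inv t m (0, partial_wt t (Suc ?k) m * strip_wt t (rowl ?k ?k),
        partial_wt t (Suc ?k) m * strip_wt t (lengthen (rowl ?k ?k)), 0)"
      using that by (intro scan_inv_runI) (simp_all add: good_iff)
    ultimately show ?thesis using fwt_rec(1,2) [OF t] by (simp add: mult.commute del: One_nat_def)
  qed
  from inv consider
      (0) "h (Suc ?k) = 0" "s = (partial_wt t ?k ?k, 0, 0, 0)"
    | (2) "h (Suc ?k) = 2" "s = (0, 0, 0, partial_wt t ?k ?k)"
    | (1) b where "h (Suc ?k) = 1" "b \<ge> Suc ?k" "\<forall>j\<in>{Suc ?k..b}. h j = 1" "h (Suc b) \<noteq> 1"
        "s = (0, partial_wt t (Suc b) ?k * strip_wt t (rowl (Suc ?k) b),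
          partial_wt t (Suc b) ?k * strip_wt t (lengthen (rowl (Suc ?k) b)), 0)"
    by blast
  then show ?thesis
  proof cases
    case 0
    show ?thesis
    proof (cases "?l \<and> \<not> ?n")
      case True
      then show ?thesis using start hk 0 by simp
    next
      case False
      then show ?thesis using hk 0 left right [of ?k]
        by (cases ?l; cases ?n) (simp_all add: scan_inv_def good_iff)
    qed
  next
    case 2
    show ?thesis
    proof (cases "\<not> ?l \<and> ?n")
      case True
      then show ?thesis using start hk 2 by simp
    next
      case False
      then show ?thesis using hk 2 left right [of ?k]
        by (cases ?l; cases ?n) (simp_all add: scan_inv_def good_iff)
    qed
  next
    case (1 b)
    \<comment> \<open>Used when the run ends at h = 0 or h = 2: the weight kept in s becomes part of
      the finished product.\<close>
    have run: "partial_wt t ?k k = partial_wt t (Suc b) k * strip_wt t (rowl (Suc ?k) b)" for k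
      using 1 by (intro partial_wt_run) auto
    show ?thesis
    proof (cases "?l = ?n")
      case True
      then have hk1: "h ?k = 1" using hk 1 by simp
      have all: "\<forall>j\<in>{?k..b}. h j = 1"
      proof
        fix j assume "j \<in> {?k..b}"
        then show "h j = 1" using hk1 1(3) by (cases "j = ?k") auto
      qed
      have rows: "rowl ?k b = (if ?l then rowl (Suc ?k) b @ [1] else lengthen (rowl (Suc ?k) b))"
        using 1 hk1 by (intro rowl_step) auto
      note sw = strip_wt_lengthen [OF t rowl_shape [OF 1(2)]]
      have "step t ?l ?n s = (0, partial_wt t (Suc b) m * strip_wt t (rowl ?k b),
          partial_wt t (Suc b) m * strip_wt t (lengthen (rowl ?k b)), 0)"
        using True right [of "Suc b"] hk1
        by (cases ?l; cases ?n) (simp_all add: 1(5) rows sw algebra_simps del: One_nat_def)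
      moreover have "scan_inv t m \<dots>"
        using hk1 1(2,4) all by (intro scan_inv_runI) (simp_all add: good_iff)
      ultimately show ?thesis by (simp only:)
    next
      case False
      then show ?thesis using hk 1 left right [of "Suc b"] run
        by (cases ?l; cases ?n) (simp_all add: scan_inv_def good_iff)
    qed
  qed
qed

lemma scan_inv_scan:
  assumes "t + 1 \<noteq> 0" "scan_inv t m s"
  shows "scan t m (set lam) (set nu) s =
    (if thin 0 then (if h 1 = 2 then 2 else 1) * partial_wt t 0 0 else 0)"
  using assms(2)
proof (induction m arbitrary: s)
  case (Suc m)
  then show ?case using scan_inv_step [OF assms(1) Suc.prems] by simp
next
  case 0
  show ?case
  proof (cases "thin 0")
    case True
    from 0 [unfolded scan_inv_def if_P [OF True]] consider
        "h 1 = 0" "s = (partial_wt t 0 0, 0, 0, 0)" | "h 1 = 2" "s = (0, 0, 0, partial_wt t 0 0)"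
      | b where "h 1 = 1" "b \<ge> 1" "\<forall>j\<in>{1..b}. h j = 1" "h (Suc b) \<noteq> 1"
        "s = (0, partial_wt t (Suc b) 0 * strip_wt t (rowl 1 b), partial_wt t (Suc b) 0 * strip_wt t (lengthen (rowl 1 b)), 0)"
      unfolding One_nat_def by blast
    then show ?thesis
    proof cases
      case (3 b)
      \<comment> \<open>A run that reaches the main diagonal is closed by the end of the
        scan.\<close>
      then have "partial_wt t 0 0 = partial_wt t (Suc b) 0 * strip_wt t (rowl 1 b)"
        using partial_wt_run [of 0 b] by simp
      with 3 True show ?thesis by simp
    qed (use True in simp_all)
  next
    case False
    then have "s = (0, 0, 0, 0)" using 0 unfolding scan_inv_def by (simp only: if_False)
    then show ?thesis using False by simp
  qed
qed

lemma scan_eq: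
  assumes "t + 1 \<noteq> 0" "\<And>b. b \<in> set lam \<union> set nu \<Longrightarrow> b \<le> M"
  shows "scan t M (set lam) (set nu) (1, 0, 0, 0) =
    (if thin 0 then (if h 1 = 2 then 2 else 1) * partial_wt t 0 0 else 0)"
proof (rule scan_inv_scan [OF assms(1)])
  have h0: "h j = 0" if "j > M" for j
  proof -
    have "b < j" if "b \<in> set lam \<union> set nu" for b using assms(2) [OF that] \<open>j > M\<close> by simp
    then have "parts_ge lam j = 0" "parts_ge nu j = 0" by (simp_all add: parts_ge_eq_0)
    then show ?thesis by (simp add: h_def)
  qed
  then have empty: "{j. M < j \<and> h j = 2} = {}" "{j. M < j \<and> h j = 1} = {}" by auto
  have "partial_wt t M M = 1" unfolding partial_wt_def empty by simp
  then show "scan_inv t M (1, 0, 0, 0)" using h0 by (simp add: scan_inv_def thin_def)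
qed

section \<open>From the counting function h back to diagonals and components\<close>

lemma diagonal_Int_skew:
  "diagonal (int k) \<inter> skew lam nu = (\<lambda>i. (i, i + k)) ` {parts_ge nu (Suc k)<..parts_ge lam (Suc k)}"
proof -
  have "(i, j) \<in> diagonal (int k) \<longleftrightarrow> j = i + k" for i j by (auto simp: diagonal_def)
  then show ?thesis by (auto simp: mem_skew lam nu image_iff)
qed

lemma card_diagonal:
  "card (diagonal d \<inter> skew lam nu) = (if d < 0 then 0 else nat (h (Suc (nat d))))"
proof (cases "d < 0")
  case True
  then have "diagonal d \<inter> skew lam nu = {}" by (auto simp: diagonal_def mem_skew lam nu)
  then show ?thesis using True by simp
next
  case False
  then obtain k where "d = int k" by (metis nonneg_int_cases not_less)
  then show ?thesis
    by (simp add: diagonal_Int_skew card_image inj_on_def h_def)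
qed

lemma double_diagonals_skew: "double_diagonals (skew lam nu) = card {j. 0 < j \<and> h j = 2}"
proof -
  have "{d. card (diagonal d \<inter> skew lam nu) = 2} = (\<lambda>j. int j - 1) ` {j. 0 < j \<and> h j = 2}"
  proof (intro equalityI subsetI)
    fix d assume "d \<in> {d. card (diagonal d \<inter> skew lam nu) = 2}"
    then have "d \<ge> 0" "h (Suc (nat d)) = 2" by (auto simp: card_diagonal split: if_splits)
    then show "d \<in> (\<lambda>j. int j - 1) ` {j. 0 < j \<and> h j = 2}"
      by (intro image_eqI [of _ _ "Suc (nat d)"]) auto
  qed (auto simp: card_diagonal gr0_conv_Suc)
  then show ?thesis by (simp add: double_diagonals_def card_image inj_on_def)
qed

lemma beta_skew: "beta (skew lam nu) = sq ` {j. 0 < j \<and> h j = 1}"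
proof -
  have "diagonal (int k) \<inter> skew lam nu = {sq (Suc k)}" if "h (Suc k) = 1" for k
  proof -
    have "{parts_ge nu (Suc k)<..parts_ge lam (Suc k)} = {parts_ge lam (Suc k)}"
      using that by (auto simp: h_def)
    then show ?thesis by (simp add: diagonal_Int_skew sq_def)
  qed
  note sing = this
  have "{d. card (diagonal d \<inter> skew lam nu) = 1} = int ` {k. h (Suc k) = 1}"
  proof (intro equalityI subsetI)
    fix d assume "d \<in> {d. card (diagonal d \<inter> skew lam nu) = 1}"
    then have "d \<ge> 0" "h (Suc (nat d)) = 1" by (auto simp: card_diagonal split: if_splits)
    then show "d \<in> int ` {k. h (Suc k) = 1}" by (intro image_eqI [of _ _ "nat d"]) auto
  qed (auto simp: card_diagonal)
  then have "beta (skew lam nu) = (\<Union>k\<in>{k. h (Suc k) = 1}. diagonal (int k) \<inter> skew lam nu)"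
    unfolding beta_def by (simp only: image_image)
  also have "\<dots> = (\<Union>k\<in>{k. h (Suc k) = 1}. {sq (Suc k)})"
    by (rule SUP_cong [OF refl]) (simp only: sing mem_Collect_eq)
  also have "\<dots> = sq ` (Suc ` {k. h (Suc k) = 1})" by blast
  also have "Suc ` {k. h (Suc k) = 1} = {j. 0 < j \<and> h j = 1}"
    by (auto simp: image_iff gr0_conv_Suc)
  finally show ?thesis .
qed

lemma double_strip_iff_thin: "double_strip lam nu \<longleftrightarrow> thin 0"
proof -
  have "parts_ge nu m \<le> parts_ge lam m \<and> parts_ge lam m \<le> parts_ge nu m + 2 \<longleftrightarrow> h m \<in> {0, 1, 2}" for m
    by (auto simp: h_def)
  then show ?thesis unfolding double_strip_iff [OF lam nu] thin_def by (simp add: Suc_le_eq)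
qed

lemma double_strip_contained: "double_strip lam nu \<Longrightarrow> contained nu lam"
  by (simp add: double_strip_iff contained_iff lam nu)

lemma scan_eq_wt:
  assumes "t + 1 \<noteq> 0" "\<And>b. b \<in> set lam \<union> set nu \<Longrightarrow> b \<le> M"
  shows "scan t M (set lam) (set nu) (1, 0, 0, 0) = (if double_strip lam nu then wt t lam nu else 0)"
proof -
  have "h 1 = int (length lam) - int (length nu)"
    by (simp add: h_def parts_ge_1 lam nu)
  then have "h 1 = 2 \<longleftrightarrow> length lam = length nu + 2" by auto
  moreover have "scan t M (set lam) (set nu) (1, 0, 0, 0) =
      (if thin 0 then (if h 1 = 2 then 2 else 1) * partial_wt t 0 0 else 0)"
    using assms by (intro scan_eq) auto
  ultimately show ?thesis
    unfolding double_strip_iff_thin by (simp add: wt_def partial_wt_def double_diagonals_skew beta_skew)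
qed

end

section \<open>The adjoint action of g_k on Q-functions, and the character recursion\<close>

lemma pairing_gfun_schurQ:
  assumes lam: "strict_partition lam" and k: "k \<le> sum_list lam"
  shows "pairing (gfun k * f) (schurQ lam) =
    (\<Sum>nu | strict_partition nu \<and> contained nu lam \<and> k_double_strip k lam nu. wt q lam nu * pairing f (schurQ nu))"
proof -
  define n where "n = sum_list lam"
  define d where "d = int (n - k)"
  have lam_le: "b \<le> n" if "b \<in> set lam" for b
    using that by (simp add: n_def member_le_sum_list)
  have scan: "scan q n (set lam) (set nu) (1, 0, 0, 0) = (if double_strip lam nu then wt q lam nu else 0)"
    if mem: "nu \<in> bounded_strict n d" for nu
  proof -
    interpret strict_pair lam nu
      using lam mem by unfold_locales (simp_all add: bounded_strict_def)
    show ?thesis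
      using lam_le mem by (intro scan_eq_wt q_plus_1_neq_0) (auto simp: bounded_strict_def)
  qed
  have set_eq: "{nu \<in> bounded_strict n d. double_strip lam nu} =
      {nu. strict_partition nu \<and> contained nu lam \<and> k_double_strip k lam nu}" (is "?A = ?B")
  proof (intro equalityI subsetI)
    fix nu assume mem: "nu \<in> ?A"
    then interpret strict_pair lam nu
      using lam by unfold_locales (simp_all add: bounded_strict_def)
    show "nu \<in> ?B"
      using mem k double_strip_contained
      by (auto simp: bounded_strict_def k_double_strip_def d_def n_def)
  next
    fix nu assume nu: "nu \<in> ?B"
    then have "sum_list nu = n - k" "n - k \<le> n" by (auto simp: k_double_strip_def n_def)
    then have "b \<le> n" if "b \<in> set nu" for b
      using member_le_sum_list [OF that] by simp
    then show "nu \<in> ?A"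
      using nu by (auto simp: bounded_strict_def k_double_strip_def d_def n_def)
  qed
  \<comment> \<open>Since k \<le> n, the natural subtraction in d is exact and E has index n - d =
    k.\<close>
  have "pairing (gfun k * f) (schurQ lam) = pairing f (E (int n - d) (schurQ lam))"
    using k by (simp add: gfun_eq_wave pairing_wave_mult d_def n_def)
  also have "\<dots> = pairing f (expand n (set lam) d (1, 0, 0, 0))"
    using E_schurQ [OF lam lam_le] by (simp add: n_def)
  also have "\<dots> = (\<Sum>nu\<in>bounded_strict n d. if double_strip lam nu then wt q lam nu * pairing f (schurQ nu) else 0)"
    unfolding expand_eq_sum pairing_sum_right pairing_const_mult_right
    by (intro sum.cong refl) (simp add: scan)
  also have "\<dots> = (\<Sum>nu\<in>?A. wt q lam nu * pairing f (schurQ nu))"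
    by (rule sum.inter_filter [OF finite_bounded_strict, symmetric])
  finally show ?thesis unfolding set_eq .
qed

theorem corollary3p11:
  fixes n :: nat and lam mu :: "nat list"
  assumes "n \<ge> 1" and "lam \<in> SP n" and "mu \<in> OP n"
  shows "zeta lam mu =
    (\<Sum>nu | strict_partition nu \<and> contained nu lam \<and> k_double_strip (hd mu) lam nu.
       2 powi (int (epsilon nu) - int (epsilon lam)) * inverse (q - 1) * wt q lam nu * zeta nu (tl mu))"
proof -
  obtain k mu' where mu: "mu = k # mu'"
    using assms(1,3) by (cases mu) (auto simp: OP_def)
  have lam: "strict_partition lam" and k: "k \<le> sum_list lam"
    using assms(2,3) by (auto simp: SP_def OP_def mu)
  \<comment> \<open>The normalising factors of the two characters differ by 2^(epsilon(\<nu>) -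
    epsilon(\<lambda>)) and by one factor (q - 1)^(-1) for the removed part.\<close>
  have scal: "2 powi (- int (epsilon lam)) * (q - 1) powi (- int (length mu)) =
      2 powi (int (epsilon nu) - int (epsilon lam)) * inverse (q - 1)
        * (2 powi (- int (epsilon nu)) * (q - 1) powi (- int (length mu')))" for nu
  proof -
    have "(2 :: ratfun) powi (- int (epsilon lam)) =
        2 powi (int (epsilon nu) - int (epsilon lam)) * 2 powi (- int (epsilon nu))"
      by (subst power_int_add [symmetric]) simp_all
    moreover have "(q - 1) powi (- int (length mu)) = inverse (q - 1) * (q - 1) powi (- int (length mu'))"
      using power_int_add [of "q - 1" "- 1" "- int (length mu')"] q_minus_1_neq_0
      by (simp add: mu power_int_minus)
    ultimately show ?thesis by (simp add: mult_ac)
  qed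
  have "zeta lam mu = 2 powi (- int (epsilon lam)) * (q - 1) powi (- int (length mu))
      * pairing (gfun k * gprod mu') (schurQ lam)"
    by (simp add: zeta_def gprod_def mu)
  also have "\<dots> = (\<Sum>nu | strict_partition nu \<and> contained nu lam \<and> k_double_strip k lam nu.
      2 powi (int (epsilon nu) - int (epsilon lam)) * inverse (q - 1) * wt q lam nu * zeta nu mu')"
    unfolding pairing_gfun_schurQ [OF lam k] sum_distrib_left
  proof (intro sum.cong refl)
    fix nu
    show "2 powi (- int (epsilon lam)) * (q - 1) powi (- int (length mu))
        * (wt q lam nu * pairing (gprod mu') (schurQ nu))
      = 2 powi (int (epsilon nu) - int (epsilon lam)) * inverse (q - 1) * wt q lam nu * zeta nu mu'"
      unfolding scal [of nu] zeta_def by (simp only: mult_ac)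
  qed
  finally show ?thesis by (simp add: mu)
qed

end
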